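(* Let $0<\alpha\leq2$. There exists $C>0$ such that for all $u\in\mathcal{S}(\mathbb{R})$ and all $A>1$, $$\left\|\left[|D|^\alpha,\sqrt{\phi_A}\right]u\right\|_{L^2}+\left\|\left[|D|^\alpha,\sqrt{1-\phi_A}\right]u\right\|_{L^2}\leq\begin{cases}\displaystyle\frac{C}{A^\alpha}\|u\|_{L^2},&\alpha\in(0,1],\\[2mm]\displaystyle\frac{C}{A^{\frac\alpha2}}\|u\|_{H^{\frac\alpha2}},&\alpha\in(1,2].\end{cases}$$
   Context: $|D|^\alpha$ is the Fourier multiplier with symbol $|\xi|^\alpha$; $[\cdot,\cdot]$ is the commutator, with a function identified with the multiplication operator by it; $\langle s\rangle=(1+s^2)^{1/2}$. Here $$\phi(y)=\left(\int_{-\infty}^{+\infty}\frac{ds}{\langle s\rangle^{1+\alpha}}\right)^{-1}\int_y^{+\infty}\frac{ds}{\langle s\rangle^{1+\alpha}},\qquad \phi_A(y)=\phi\left(\frac yA\right).$$ The constant $C$ depends only on $\alpha$. *)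

theory Defs
  imports "HOL-Analysis.Analysis"
begin

section \<open>Schwartz functions on the real line\<close>

definition nth_deriv :: "nat \<Rightarrow> (real \<Rightarrow> complex) \<Rightarrow> real \<Rightarrow> complex" where
  "nth_deriv n f = ((\<lambda>g x. vector_derivative g (at x)) ^^ n) f"

definition schwartz :: "(real \<Rightarrow> complex) \<Rightarrow> bool" where
  "schwartz f \<longleftrightarrow>
     (\<forall>n x. nth_deriv n f differentiable at x) \<and>
     (\<forall>k n. \<exists>M. \<forall>x. \<bar>x\<bar> ^ k * norm (nth_deriv n f x) \<le> M)"

section \<open>Fourier multipliers and commutators\<close>

definition fourier :: "(real \<Rightarrow> complex) \<Rightarrow> real \<Rightarrow> complex" where
  "fourier f \<xi> = (LINT x|lborel. cis (- (x * \<xi>)) * f x)"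

definition inverse_fourier :: "(real \<Rightarrow> complex) \<Rightarrow> real \<Rightarrow> complex" where
  "inverse_fourier g x = (LINT \<xi>|lborel. cis (x * \<xi>) * g \<xi>) / complex_of_real (2 * pi)"

text \<open>
  The Bochner integrals in the multiplier converge absolutely whenever \<open>f\<close> is Schwartz and
  \<open>m\<close> is measurable of at most polynomial growth. Below, multipliers are only
  applied to Schwartz functions: multiplication by \<open>sqrt \<circ> \<phi>\<^sub>A\<close> or
  \<open>sqrt \<circ> (1 - \<phi>\<^sub>A)\<close> preserves the Schwartz class, because
  \<open>0 < \<phi>\<^sub>A < 1\<close> and these weights are smooth with bounded derivatives.
\<close>

definition fourier_multiplier ::
    "(real \<Rightarrow> real) \<Rightarrow> (real \<Rightarrow> complex) \<Rightarrow> real \<Rightarrow> complex" where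
  "fourier_multiplier m f = inverse_fourier (\<lambda>\<xi>. m \<xi> *\<^sub>R fourier f \<xi>)"

definition abs_D :: "real \<Rightarrow> (real \<Rightarrow> complex) \<Rightarrow> real \<Rightarrow> complex" where
  "abs_D \<alpha> = fourier_multiplier (\<lambda>\<xi>. \<bar>\<xi>\<bar> powr \<alpha>)"

definition mult_op :: "(real \<Rightarrow> real) \<Rightarrow> (real \<Rightarrow> complex) \<Rightarrow> real \<Rightarrow> complex" where
  "mult_op g f = (\<lambda>x. g x *\<^sub>R f x)"

definition commutator ::
    "((real \<Rightarrow> complex) \<Rightarrow> real \<Rightarrow> complex) \<Rightarrow> ((real \<Rightarrow> complex) \<Rightarrow> real \<Rightarrow> complex) \<Rightarrow>
     (real \<Rightarrow> complex) \<Rightarrow> real \<Rightarrow> complex" where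
  "commutator S T f = (\<lambda>x. S (T f) x - T (S f) x)"

section \<open>Norms\<close>

text \<open>
  Extended-valued, so that finiteness of a norm is part of any upper bound on it
  (a Bochner integral would silently be 0 for functions that are not square integrable).
\<close>

definition L2_norm :: "(real \<Rightarrow> complex) \<Rightarrow> ennreal" where
  "L2_norm f =
     (let I = (\<integral>\<^sup>+ x. ennreal ((norm (f x))\<^sup>2) \<partial>lborel)
      in if I = \<infinity> then \<infinity> else ennreal (sqrt (enn2real I)))"

definition japanese :: "real \<Rightarrow> real" where
  "japanese s = sqrt (1 + s\<^sup>2)"

text \<open>
  The factor is the Plancherel constant of this Fourier transform; it makes the
  norm with \<open>s = 0\<close> coincide with the \<open>L\<^sup>2\<close> norm.
\<close>

definition sobolev_norm :: "real \<Rightarrow> (real \<Rightarrow> complex) \<Rightarrow> ennreal" where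
  "sobolev_norm s f =
     ennreal (1 / sqrt (2 * pi)) * L2_norm (\<lambda>\<xi>. (japanese \<xi> powr s) *\<^sub>R fourier f \<xi>)"

section \<open>The weight\<close>

definition phi :: "real \<Rightarrow> real \<Rightarrow> real" where
  "phi \<alpha> y =
     inverse (LINT s|lborel. 1 / japanese s powr (1 + \<alpha>)) *
     (LINT s:{y..}|lborel. 1 / japanese s powr (1 + \<alpha>))"

definition phi_scaled :: "real \<Rightarrow> real \<Rightarrow> real \<Rightarrow> real" where
  "phi_scaled \<alpha> A y = phi \<alpha> (y / A)"

end

theory Submission
  imports Defs "HOL-Probability.Probability"
begin

text \<open>
  Write \<open>g = sqrt \<circ> \<phi>\<close>.  The substitution \<open>s \<mapsto> - s\<close> gives
  \<open>1 - \<phi> y = \<phi> (- y)\<close>, so both weights of the theorem have the form \<open>y \<mapsto> g (a y)\<close>, with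
  \<open>a = 1 / A\<close> and \<open>a = - 1 / A\<close>, and one commutator estimate with the right dependence on \<open>\<bar>a\<bar>\<close> suffices.

  The function \<open>g\<close> tends to 1 at \<open>-\<infinity>\<close> and is not integrable, but \<open>g'\<close> is as good as needed: it is smooth
  and \<open>g'\<close> and its derivatives are \<open>O(\<langle>y\<rangle> powr - (1 + \<alpha> / 2))\<close>.  Its Fourier
  transform \<open>G\<close> is therefore bounded and decays faster than any power.  Integrating the inversion formula for
  \<open>g'\<close> gives (\<open>sqrt_phi_representation\<close>)
  \<open>g x = g 0 + \<integral> (cis (x \<zeta>) - 1) H \<zeta> d\<zeta>\<close> with \<open>H \<zeta> = G \<zeta> / (2 \<pi> \<i> \<zeta>)\<close>.
  Constants commute with \<open>|D|\<^sup>\<alpha>\<close>, and multiplication by \<open>cis (a x \<zeta>)\<close> translates the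
  Fourier transform by \<open>a \<zeta>\<close>.  Hence the Fourier transform of the commutator applied to \<open>u\<close> is
  \<open>\<integral> (|\<xi>|\<^sup>\<alpha> - |\<xi> - a \<zeta>|\<^sup>\<alpha>) (fourier u) (\<xi> - a \<zeta>) H \<zeta> d\<zeta>\<close>
  (\<open>commutator_eq_inverse_fourier\<close>).

  Let \<open>\<eta> = \<xi> - a \<zeta>\<close>.  For \<open>\<alpha> \<le> 1\<close> subadditivity of the power bounds the difference
  of the symbols by \<open>|a \<zeta>|\<^sup>\<alpha>\<close>.  For \<open>1 < \<alpha> \<le> 2\<close> the mean value theorem bounds it by a
  multiple of \<open>|a \<zeta>|\<^sup>\<alpha> + |a \<zeta>| |\<eta>| powr (\<alpha> - 1)\<close>; since \<open>\<alpha> - 1 \<le> \<alpha> / 2\<close> and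
  \<open>|a| \<le> 1\<close>, this is at most a multiple of
  \<open>|a| powr (\<alpha> / 2) (|\<zeta>|\<^sup>\<alpha> + |\<zeta>|) \<langle>\<eta>\<rangle> powr (\<alpha> / 2)\<close>.  Young's inequality for an
  integrable kernel against a square integrable function and the Plancherel inequality turn these pointwise
  bounds into the claim, with a constant proportional to
  \<open>\<integral> (|\<zeta>|\<^sup>\<alpha> + |\<zeta>|) |H \<zeta>| d\<zeta>\<close>.  This is finite because
  \<open>|\<zeta>|\<^sup>\<alpha> |H \<zeta>|\<close> behaves like \<open>|\<zeta>| powr (\<alpha> - 1)\<close> near 0, where \<open>\<alpha> > 0\<close> is used.

  Besides integration by parts, two facts of Fourier analysis enter, inversion for nice functions and the inequality half of Plancherel.
  Both come from one identity, the Gaussian mean of \<open>fourier f\<close> (\<open>fourier_gauss_mean\<close>).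
\<close>

section \<open>Fubini along a shear and basic facts on the Fourier transform\<close>

text \<open>
  The Bochner integrals below are interchanged for functions dominated by a product, possibly after the
  shear \<open>(x, z) \<mapsto> (x - a z, z)\<close>, which preserves Lebesgue measure; the case \<open>a = 0\<close> is a plain product.
\<close>

lemma integrable_shear_bound:
  fixes F :: "real \<Rightarrow> real \<Rightarrow> complex"
  assumes meas [measurable]: "case_prod F \<in> borel_measurable (lborel \<Otimes>\<^sub>M lborel)"
    and W: "integrable lborel W" and V: "integrable lborel V"
    and bound: "\<And>x z. norm (F x z) \<le> W z * V (x - a * z)"
  shows "integrable (lborel \<Otimes>\<^sub>M lborel) (case_prod F)"
proof (rule integrableI_bounded)
  show "case_prod F \<in> borel_measurable (lborel \<Otimes>\<^sub>M lborel)" by (rule meas)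
  have [measurable]: "W \<in> borel_measurable borel" "V \<in> borel_measurable borel"
    using borel_measurable_integrable[OF W] borel_measurable_integrable[OF V] by auto
  have shift: "(\<integral>\<^sup>+x. ennreal \<bar>V (x - a * z)\<bar> \<partial>lborel) = (\<integral>\<^sup>+x. ennreal \<bar>V x\<bar> \<partial>lborel)" for z
    using nn_integral_real_affine[of "\<lambda>x. ennreal \<bar>V x\<bar>" 1 "- (a * z)"] by simp
  have "(\<integral>\<^sup>+p. ennreal (norm (case_prod F p)) \<partial>(lborel \<Otimes>\<^sub>M lborel))
      = (\<integral>\<^sup>+z. (\<integral>\<^sup>+x. ennreal (norm (F x z)) \<partial>lborel) \<partial>lborel)"
    by (subst lborel_pair.nn_integral_snd[symmetric]) auto
  also have "\<dots> \<le> (\<integral>\<^sup>+z. (\<integral>\<^sup>+x. ennreal \<bar>W z\<bar> * ennreal \<bar>V (x - a * z)\<bar> \<partial>lborel) \<partial>lborel)"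
    by (intro nn_integral_mono)
      (auto simp: ennreal_mult[symmetric] abs_mult[symmetric] intro!: ennreal_leI order_trans[OF bound])
  also have "\<dots> = (\<integral>\<^sup>+z. ennreal \<bar>W z\<bar> \<partial>lborel) * (\<integral>\<^sup>+x. ennreal \<bar>V x\<bar> \<partial>lborel)"
    by (simp add: nn_integral_cmult nn_integral_multc shift)
  also have "\<dots> < \<infinity>"
    using W V by (simp add: integrable_iff_bounded ennreal_mult_less_top)
  finally show "(\<integral>\<^sup>+p. ennreal (norm (case_prod F p)) \<partial>(lborel \<Otimes>\<^sub>M lborel)) < \<infinity>" .
qed

lemma measurable_cis_compose [measurable]:
  assumes "f \<in> borel_measurable M" shows "(\<lambda>x. cis (f x)) \<in> borel_measurable M"
proof -
  have "cis \<in> borel_measurable borel"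
    by (intro borel_measurable_continuous_onI continuous_intros)
  then show ?thesis by (rule measurable_compose[OF assms])
qed

lemma integrable_cis_mult:
  fixes f :: "real \<Rightarrow> complex"
  assumes "integrable lborel f" and [measurable]: "g \<in> borel_measurable borel"
  shows "integrable lborel (\<lambda>x. cis (g x) * f x)"
  using assms(1) by (rule Bochner_Integration.integrable_bound)
    (use borel_measurable_integrable[OF assms(1)] in \<open>auto simp: norm_mult\<close>)

lemma measurable_fourier [measurable]:
  assumes "integrable lborel f"
  shows "fourier f \<in> borel_measurable borel"
proof -
  have [measurable]: "f \<in> borel_measurable borel" using borel_measurable_integrable[OF assms] by simp
  show ?thesis unfolding fourier_def[abs_def] by measurable
qed

lemma norm_fourier_le: "norm (fourier f \<xi>) \<le> (LINT x|lborel. norm (f x))"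
proof -
  have "norm (fourier f \<xi>) \<le> (LINT x|lborel. norm (cis (- (x * \<xi>)) * f x))"
    unfolding fourier_def by (rule integral_norm_bound)
  then show ?thesis by (simp add: norm_mult)
qed

section \<open>Gaussian regularisation, Plancherel inequality and inversion\<close>

text \<open>
  The characteristic function of the standard normal distribution says that the Gaussian is its own Fourier
  transform.
\<close>

lemma integral_cis_std_normal_density:
  "(LINT x|lborel. cis (t * x) * complex_of_real (std_normal_density x)) = complex_of_real (exp (- t\<^sup>2 / 2))"
proof -
  have "complex_of_real (exp (- t\<^sup>2 / 2)) = char std_normal_distribution t"
    by (simp add: char_std_normal_distribution)
  also have "\<dots> = (LINT x|lborel. cis (t * x) * complex_of_real (std_normal_density x))"
    unfolding char_def by (subst integral_density) (auto simp: scaleR_conv_of_real cis_conv_exp mult_ac)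
  finally show ?thesis by simp
qed

lemma integrable_std_normal_density_scaled:
  assumes "\<epsilon> > 0"
  shows "integrable lborel (\<lambda>x. std_normal_density (\<epsilon> * x))"
  using lborel_integrable_real_affine[of std_normal_density \<epsilon> 0] assms by simp

lemma integral_cis_std_normal_density_scaled:
  assumes "\<epsilon> > 0"
  shows "(LINT x|lborel. cis (s * x) * complex_of_real (std_normal_density (\<epsilon> * x)))
       = complex_of_real (exp (- (s / \<epsilon>)\<^sup>2 / 2) / \<epsilon>)"
proof -
  have "complex_of_real (exp (- (s / \<epsilon>)\<^sup>2 / 2))
      = \<epsilon> *\<^sub>R (LINT x|lborel. cis (s * x) * complex_of_real (std_normal_density (\<epsilon> * x)))"
    unfolding integral_cis_std_normal_density[symmetric]
    by (subst lborel_integral_real_affine[where c = \<epsilon> and t = 0]) (use assms in auto)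
  then show ?thesis using assms by (simp add: scaleR_conv_of_real field_simps)
qed

text \<open>
  Multiplying \<open>fourier f\<close> by a Gaussian makes Fubini applicable, and the Gaussian becomes an approximate
  identity acting on \<open>f\<close>.  Both the Plancherel inequality and the inversion formula are the limit
  \<open>\<epsilon> \<rightarrow> 0\<close> of this identity.
\<close>

lemma fourier_gauss_mean:
  assumes f: "integrable lborel f" and eps: "\<epsilon> > 0"
  shows "(LINT \<xi>|lborel. cis (x * \<xi>) * complex_of_real (std_normal_density (\<epsilon> * \<xi>)) * fourier f \<xi>)
       = (LINT y|lborel. f y * complex_of_real (exp (- ((x - y) / \<epsilon>)\<^sup>2 / 2) / \<epsilon>))"
proof -
  have [measurable]: "f \<in> borel_measurable borel" using borel_measurable_integrable[OF f] by simp
  define K where "K \<xi> y = cis (x * \<xi>) * complex_of_real (std_normal_density (\<epsilon> * \<xi>)) * (cis (- (y * \<xi>)) * f y)" for \<xi> y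
  have [measurable]: "case_prod K \<in> borel_measurable (lborel \<Otimes>\<^sub>M lborel)" unfolding K_def by measurable
  have K: "integrable (lborel \<Otimes>\<^sub>M lborel) (case_prod K)"
    by (rule integrable_shear_bound[where a = 0 and W = "\<lambda>y. norm (f y)" and V = "\<lambda>\<xi>. std_normal_density (\<epsilon> * \<xi>)"])
      (use f eps in \<open>auto simp: K_def norm_mult integrable_std_normal_density_scaled\<close>)
  have "(LINT \<xi>|lborel. cis (x * \<xi>) * complex_of_real (std_normal_density (\<epsilon> * \<xi>)) * fourier f \<xi>)
      = (LINT \<xi>|lborel. LINT y|lborel. K \<xi> y)"
    unfolding fourier_def K_def by (simp only: integral_mult_right_zero)
  also have "\<dots> = (LINT y|lborel. LINT \<xi>|lborel. K \<xi> y)"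
    by (rule lborel_pair.Fubini_integral[OF K, symmetric])
  also have "\<dots> = (LINT y|lborel. f y * complex_of_real (exp (- ((x - y) / \<epsilon>)\<^sup>2 / 2) / \<epsilon>))"
  proof (rule Bochner_Integration.integral_cong[OF refl])
    fix y
    have "K \<xi> y = f y * (cis ((x - y) * \<xi>) * complex_of_real (std_normal_density (\<epsilon> * \<xi>)))" for \<xi>
      unfolding K_def by (simp add: algebra_simps cis_mult)
    then show "(LINT \<xi>|lborel. K \<xi> y) = f y * complex_of_real (exp (- ((x - y) / \<epsilon>)\<^sup>2 / 2) / \<epsilon>)"
      using integral_cis_std_normal_density_scaled[OF eps, of "x - y"] by simp
  qed
  finally show ?thesis .
qed

lemma nn_integral_gauss:
  assumes "\<epsilon> > 0"
  shows "(\<integral>\<^sup>+y. ennreal (exp (- ((x - y) / \<epsilon>)\<^sup>2 / 2) / \<epsilon>) \<partial>lborel) = ennreal (sqrt (2 * pi))"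
proof -
  have "(\<integral>\<^sup>+y. ennreal (exp (- ((x - y) / \<epsilon>)\<^sup>2 / 2) / \<epsilon>) \<partial>lborel)
      = ennreal \<epsilon> * (\<integral>\<^sup>+z. ennreal (exp (- ((x - (x + \<epsilon> * z)) / \<epsilon>)\<^sup>2 / 2) / \<epsilon>) \<partial>lborel)"
    using assms by (subst nn_integral_real_affine[where t = x and c = \<epsilon>]) auto
  also have "\<dots> = (\<integral>\<^sup>+z. ennreal (exp (- z\<^sup>2 / 2)) \<partial>lborel)"
    using assms by (subst nn_integral_cmult[symmetric]) (auto simp: ennreal_mult[symmetric])
  also have "\<dots> = (\<integral>\<^sup>+z. ennreal (sqrt (2 * pi)) * ennreal (std_normal_density z) \<partial>lborel)"
    by (intro nn_integral_cong) (auto simp: ennreal_mult[symmetric] std_normal_density_def)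
  also have "\<dots> = ennreal (sqrt (2 * pi)) * (\<integral>\<^sup>+z. ennreal (std_normal_density z) \<partial>lborel)"
    by (rule nn_integral_cmult) auto
  also have "(\<integral>\<^sup>+z. ennreal (std_normal_density z) \<partial>lborel) = 1"
    by (subst nn_integral_eq_integral) auto
  finally show ?thesis by simp
qed

text \<open>
  By the preceding identity the damped square integral equals the double integral of
  \<open>f y * cnj (f x)\<close> against a Gaussian in \<open>x - y\<close>.  The inequality
  \<open>|f x| |f y| \<le> (|f x|\<^sup>2 + |f y|\<^sup>2) / 2\<close> reduces this to the mass of the Gaussian, which does not
  depend on \<open>\<epsilon>\<close>.
\<close>

lemma fourier_damped_bound:
  assumes f: "integrable lborel f" and eps: "\<epsilon> > 0"
  shows "(\<integral>\<^sup>+\<xi>. ennreal (std_normal_density (\<epsilon> * \<xi>) * (norm (fourier f \<xi>))\<^sup>2) \<partial>lborel)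
       \<le> ennreal (sqrt (2 * pi)) * (\<integral>\<^sup>+x. ennreal ((norm (f x))\<^sup>2) \<partial>lborel)"
proof -
  have [measurable]: "f \<in> borel_measurable borel" using borel_measurable_integrable[OF f] by simp
  note [measurable] = measurable_fourier[OF f]
  define E where "E s = exp (- (s / \<epsilon>)\<^sup>2 / 2) / \<epsilon>" for s
  have E0: "E s \<ge> 0" for s using eps by (simp add: E_def)
  have [measurable]: "E \<in> borel_measurable borel" unfolding E_def[abs_def] by measurable
  have intE: "(\<integral>\<^sup>+y. ennreal (E (x - y)) \<partial>lborel) = ennreal (sqrt (2 * pi))"
    "(\<integral>\<^sup>+y. ennreal (E (y - x)) \<partial>lborel) = ennreal (sqrt (2 * pi))" for x
    using nn_integral_gauss[OF eps, of x] by (auto simp: E_def power2_commute power_divide)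
  define N where "N = (LINT x|lborel. norm (f x))"
  define w where "w \<xi> = std_normal_density (\<epsilon> * \<xi>)" for \<xi>
  have w0: "w \<xi> \<ge> 0" for \<xi> by (simp add: w_def)
  have [measurable]: "w \<in> borel_measurable borel" unfolding w_def[abs_def] by measurable
  have w: "integrable lborel w"
    unfolding w_def[abs_def] by (rule integrable_std_normal_density_scaled[OF eps])
  have FN: "norm (fourier f \<xi>) \<le> N" for \<xi> unfolding N_def by (rule norm_fourier_le)
  have N0: "N \<ge> 0" unfolding N_def by simp
  have int: "integrable lborel (\<lambda>\<xi>. w \<xi> * (norm (fourier f \<xi>))\<^sup>2)"
    by (rule Bochner_Integration.integrable_bound[where f = "\<lambda>\<xi>. w \<xi> * N\<^sup>2"])
      (use w w0 FN N0 in \<open>auto simp: abs_mult intro!: mult_left_mono power_mono\<close>)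
  define K where "K \<xi> x = cis (x * \<xi>) * complex_of_real (w \<xi>) * fourier f \<xi> * cnj (f x)" for \<xi> x
  have [measurable]: "(\<lambda>x. cnj (f x)) \<in> borel_measurable borel"
    by (rule borel_measurable_continuous_on[of cnj]) (auto intro: continuous_intros)
  have K: "integrable (lborel \<Otimes>\<^sub>M lborel) (case_prod K)"
  proof (rule integrable_shear_bound[where a = 0 and W = "\<lambda>y. norm (f y)" and V = "\<lambda>\<xi>. w \<xi> * N"])
    show "case_prod K \<in> borel_measurable (lborel \<Otimes>\<^sub>M lborel)" unfolding K_def by measurable
    show "norm (K x z) \<le> norm (f z) * (w (x - 0 * z) * N)" for x z
      using mult_mono[OF order_refl[of "norm (f z)"] mult_left_mono[OF FN[of x] w0[of x]]] w0[of x]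
      by (simp add: K_def norm_mult mult_ac)
  qed (use f w in auto)
  have "complex_of_real (LINT \<xi>|lborel. w \<xi> * (norm (fourier f \<xi>))\<^sup>2) = (LINT \<xi>|lborel. LINT x|lborel. K \<xi> x)"
  proof -
    have "complex_of_real (w \<xi> * (norm (fourier f \<xi>))\<^sup>2) = (LINT x|lborel. K \<xi> x)" for \<xi>
    proof -
      have "cnj (fourier f \<xi>) = (LINT x|lborel. cis (x * \<xi>) * cnj (f x))"
        unfolding fourier_def by (simp add: cis_cnj flip: Bochner_Integration.integral_cnj)
      then have "(LINT x|lborel. K \<xi> x) = complex_of_real (w \<xi>) * (fourier f \<xi> * cnj (fourier f \<xi>))"
        unfolding K_def by (simp add: mult_ac flip: integral_mult_right_zero)
      then show ?thesis unfolding of_real_mult complex_norm_square by simp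
    qed
    then show ?thesis by (simp flip: integral_complex_of_real)
  qed
  also have "\<dots> = (LINT x|lborel. LINT \<xi>|lborel. K \<xi> x)"
    by (rule lborel_pair.Fubini_integral[OF K, symmetric])
  also have "\<dots> = (LINT x|lborel. (LINT y|lborel. f y * complex_of_real (E (x - y))) * cnj (f x))"
  proof (rule Bochner_Integration.integral_cong[OF refl])
    fix x
    show "(LINT \<xi>|lborel. K \<xi> x) = (LINT y|lborel. f y * complex_of_real (E (x - y))) * cnj (f x)"
      unfolding K_def w_def integral_mult_left_zero fourier_gauss_mean[OF f eps] E_def ..
  qed
  finally have eq: "complex_of_real (LINT \<xi>|lborel. w \<xi> * (norm (fourier f \<xi>))\<^sup>2) = \<dots>" .
  have "(\<integral>\<^sup>+\<xi>. ennreal (w \<xi> * (norm (fourier f \<xi>))\<^sup>2) \<partial>lborel) = ennreal (LINT \<xi>|lborel. w \<xi> * (norm (fourier f \<xi>))\<^sup>2)"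
    by (rule nn_integral_eq_integral[OF int]) (simp add: w0)
  also have "(LINT \<xi>|lborel. w \<xi> * (norm (fourier f \<xi>))\<^sup>2) \<le> norm (complex_of_real (LINT \<xi>|lborel. w \<xi> * (norm (fourier f \<xi>))\<^sup>2))"
    by simp
  then have "ennreal (LINT \<xi>|lborel. w \<xi> * (norm (fourier f \<xi>))\<^sup>2) \<le> ennreal \<dots>" by (rule ennreal_leI)
  also have "ennreal (norm (complex_of_real (LINT \<xi>|lborel. w \<xi> * (norm (fourier f \<xi>))\<^sup>2)))
      \<le> (\<integral>\<^sup>+x. ennreal (norm ((LINT y|lborel. f y * complex_of_real (E (x - y))) * cnj (f x))) \<partial>lborel)"
    unfolding eq by (cases "integrable lborel (\<lambda>x. (LINT y|lborel. f y * complex_of_real (E (x - y))) * cnj (f x))")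
      (auto intro: integral_norm_bound_ennreal simp: not_integrable_integral_eq)
  also have "\<dots> \<le> (\<integral>\<^sup>+x. (\<integral>\<^sup>+y. ennreal (norm (f y) * norm (f x) * E (x - y)) \<partial>lborel) \<partial>lborel)"
  proof (rule nn_integral_mono)
    fix x
    have "ennreal (norm ((LINT y|lborel. f y * complex_of_real (E (x - y))) * cnj (f x)))
       = ennreal (norm (LINT y|lborel. f y * complex_of_real (E (x - y)))) * ennreal (norm (f x))"
      by (simp add: norm_mult ennreal_mult)
    also have "\<dots> \<le> (\<integral>\<^sup>+y. ennreal (norm (f y * complex_of_real (E (x - y)))) \<partial>lborel) * ennreal (norm (f x))"
      by (intro mult_right_mono, cases "integrable lborel (\<lambda>y. f y * complex_of_real (E (x - y)))")
        (auto intro: integral_norm_bound_ennreal simp: not_integrable_integral_eq)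
    also have "\<dots> = (\<integral>\<^sup>+y. ennreal (norm (f y) * norm (f x) * E (x - y)) \<partial>lborel)"
      by (subst nn_integral_multc[symmetric]) (auto simp: norm_mult ennreal_mult[symmetric] E0 mult_ac intro!: nn_integral_cong)
    finally show "ennreal (norm ((LINT y|lborel. f y * complex_of_real (E (x - y))) * cnj (f x))) \<le> \<dots>" .
  qed
  also have "\<dots> \<le> (\<integral>\<^sup>+x. (\<integral>\<^sup>+y. ennreal ((norm (f x))\<^sup>2 / 2) * ennreal (E (x - y)) + ennreal ((norm (f y))\<^sup>2 / 2) * ennreal (E (x - y)) \<partial>lborel) \<partial>lborel)"
  proof (intro nn_integral_mono)
    fix x y
    have "norm (f y) * norm (f x) \<le> (norm (f x))\<^sup>2 / 2 + (norm (f y))\<^sup>2 / 2"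
      using sum_squares_bound[of "norm (f x)" "norm (f y)"] by (simp add: field_simps)
    from mult_right_mono[OF this E0[of "x - y"]]
    have "ennreal (norm (f y) * norm (f x) * E (x - y)) \<le> ennreal ((norm (f x))\<^sup>2 / 2 * E (x - y) + (norm (f y))\<^sup>2 / 2 * E (x - y))"
      by (intro ennreal_leI) (simp add: algebra_simps)
    also have "\<dots> = ennreal ((norm (f x))\<^sup>2 / 2) * ennreal (E (x - y)) + ennreal ((norm (f y))\<^sup>2 / 2) * ennreal (E (x - y))"
      using E0 by (subst ennreal_plus) (auto simp: ennreal_mult[symmetric])
    finally show "ennreal (norm (f y) * norm (f x) * E (x - y)) \<le> \<dots>" .
  qed
  also have "\<dots> = (\<integral>\<^sup>+x. (\<integral>\<^sup>+y. ennreal ((norm (f x))\<^sup>2 / 2) * ennreal (E (x - y)) \<partial>lborel) \<partial>lborel)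
      + (\<integral>\<^sup>+x. (\<integral>\<^sup>+y. ennreal ((norm (f y))\<^sup>2 / 2) * ennreal (E (x - y)) \<partial>lborel) \<partial>lborel)"
    by (subst nn_integral_add[symmetric]) (auto simp: nn_integral_add)
  also have "(\<integral>\<^sup>+x. (\<integral>\<^sup>+y. ennreal ((norm (f y))\<^sup>2 / 2) * ennreal (E (x - y)) \<partial>lborel) \<partial>lborel)
      = (\<integral>\<^sup>+y. (\<integral>\<^sup>+x. ennreal ((norm (f y))\<^sup>2 / 2) * ennreal (E (x - y)) \<partial>lborel) \<partial>lborel)"
    by (rule lborel_pair.Fubini') measurable
  also have "(\<integral>\<^sup>+x. (\<integral>\<^sup>+y. ennreal ((norm (f x))\<^sup>2 / 2) * ennreal (E (x - y)) \<partial>lborel) \<partial>lborel)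
      = (\<integral>\<^sup>+x. ennreal ((norm (f x))\<^sup>2 / 2) \<partial>lborel) * ennreal (sqrt (2 * pi))"
    by (simp add: nn_integral_cmult intE nn_integral_multc)
  also have "(\<integral>\<^sup>+y. (\<integral>\<^sup>+x. ennreal ((norm (f y))\<^sup>2 / 2) * ennreal (E (x - y)) \<partial>lborel) \<partial>lborel)
      = (\<integral>\<^sup>+x. ennreal ((norm (f x))\<^sup>2 / 2) \<partial>lborel) * ennreal (sqrt (2 * pi))"
    by (simp add: nn_integral_cmult intE nn_integral_multc)
  also have "(\<integral>\<^sup>+x. ennreal ((norm (f x))\<^sup>2 / 2) \<partial>lborel) * ennreal (sqrt (2 * pi)) + (\<integral>\<^sup>+x. ennreal ((norm (f x))\<^sup>2 / 2) \<partial>lborel) * ennreal (sqrt (2 * pi))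
      = ((\<integral>\<^sup>+x. ennreal ((norm (f x))\<^sup>2 / 2) \<partial>lborel) + (\<integral>\<^sup>+x. ennreal ((norm (f x))\<^sup>2 / 2) \<partial>lborel)) * ennreal (sqrt (2 * pi))"
    by (simp add: distrib_right)
  also have "(\<integral>\<^sup>+x. ennreal ((norm (f x))\<^sup>2 / 2) \<partial>lborel) + (\<integral>\<^sup>+x. ennreal ((norm (f x))\<^sup>2 / 2) \<partial>lborel) = (\<integral>\<^sup>+x. ennreal ((norm (f x))\<^sup>2) \<partial>lborel)"
    by (subst nn_integral_add[symmetric]) (auto simp: ennreal_plus[symmetric] simp del: ennreal_plus)
  finally show ?thesis by (simp add: w_def mult.commute)
qed

lemma tendsto_std_normal_density_0:
  assumes "\<epsilon> \<longlonglongrightarrow> 0"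
  shows "(\<lambda>n. std_normal_density (\<epsilon> n * x)) \<longlonglongrightarrow> 1 / sqrt (2 * pi)"
proof -
  have "(\<lambda>n. 1 / sqrt (2 * pi) * exp (- (\<epsilon> n * x)\<^sup>2 / 2)) \<longlonglongrightarrow> 1 / sqrt (2 * pi) * exp (- (0 * x)\<^sup>2 / 2)"
    by (intro tendsto_intros assms) auto
  then show ?thesis by (simp add: std_normal_density_def)
qed

text \<open>
  The inequality half of Plancherel's theorem, by Fatou's lemma as the damping is removed.  If
  \<open>f\<close> is not square integrable, the right-hand side is infinite.
\<close>

theorem fourier_L2_bound:
  assumes f: "integrable lborel f"
  shows "(\<integral>\<^sup>+\<xi>. ennreal ((norm (fourier f \<xi>))\<^sup>2) \<partial>lborel)
       \<le> ennreal (2 * pi) * (\<integral>\<^sup>+x. ennreal ((norm (f x))\<^sup>2) \<partial>lborel)"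
proof -
  note [measurable] = measurable_fourier[OF f]
  define I where "I = (\<integral>\<^sup>+x. ennreal ((norm (f x))\<^sup>2) \<partial>lborel)"
  define e where "e n = inverse (real (Suc n))" for n
  have e: "e \<longlonglongrightarrow> 0" "\<And>n. e n > 0" unfolding e_def by (rule LIMSEQ_inverse_real_of_nat) auto
  define h where "h n \<xi> = ennreal (std_normal_density (e n * \<xi>) * (norm (fourier f \<xi>))\<^sup>2)" for n \<xi>
  have [measurable]: "h n \<in> borel_measurable borel" for n unfolding h_def[abs_def] by measurable
  have "(\<lambda>n. h n \<xi>) \<longlonglongrightarrow> ennreal (1 / sqrt (2 * pi) * (norm (fourier f \<xi>))\<^sup>2)" for \<xi>
    unfolding h_def by (intro tendsto_ennrealI tendsto_intros tendsto_std_normal_density_0 e)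
  then have "liminf (\<lambda>n. h n \<xi>) = ennreal (1 / sqrt (2 * pi)) * ennreal ((norm (fourier f \<xi>))\<^sup>2)" for \<xi>
    by (subst lim_imp_Liminf) (auto simp: ennreal_mult[symmetric])
  then have "ennreal (1 / sqrt (2 * pi)) * (\<integral>\<^sup>+\<xi>. ennreal ((norm (fourier f \<xi>))\<^sup>2) \<partial>lborel)
     = (\<integral>\<^sup>+\<xi>. liminf (\<lambda>n. h n \<xi>) \<partial>lborel)"
    by (simp add: nn_integral_cmult)
  also have "\<dots> \<le> liminf (\<lambda>n. integral\<^sup>N lborel (h n))"
    by (rule nn_integral_liminf) auto
  also have "\<dots> \<le> liminf (\<lambda>n::nat. ennreal (sqrt (2 * pi)) * I)"
    unfolding h_def I_def by (intro Liminf_mono always_eventually allI fourier_damped_bound f e)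
  also have "\<dots> = ennreal (sqrt (2 * pi)) * I"
    by (rule Liminf_const) simp
  finally have "ennreal (sqrt (2 * pi)) * (ennreal (1 / sqrt (2 * pi)) * (\<integral>\<^sup>+\<xi>. ennreal ((norm (fourier f \<xi>))\<^sup>2) \<partial>lborel))
      \<le> ennreal (sqrt (2 * pi)) * (ennreal (sqrt (2 * pi)) * I)"
    by (rule mult_left_mono) simp
  then show ?thesis
    unfolding I_def by (simp add: mult.assoc[symmetric] ennreal_mult[symmetric])
qed

theorem fourier_inversion:
  assumes f: "integrable lborel f" and F: "integrable lborel (fourier f)"
    and cont: "continuous_on UNIV f" and bd: "\<And>x. norm (f x) \<le> B"
  shows "inverse_fourier (fourier f) x = f x"
proof -
  have [measurable]: "f \<in> borel_measurable borel" using borel_measurable_integrable[OF f] by simp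
  note [measurable] = measurable_fourier[OF f]
  define e where "e n = inverse (real (Suc n))" for n
  have e: "e \<longlonglongrightarrow> 0" "\<And>n. e n > 0" unfolding e_def by (rule LIMSEQ_inverse_real_of_nat) auto
  define L where "L n = (LINT \<xi>|lborel. cis (x * \<xi>) * complex_of_real (std_normal_density (e n * \<xi>)) * fourier f \<xi>)" for n
  have std1: "std_normal_density z \<le> 1" for z
  proof -
    have "1 \<le> sqrt (2 * pi)" using pi_gt3 by simp
    moreover have "exp (- z\<^sup>2 / 2) \<le> 1" by simp
    ultimately show ?thesis unfolding std_normal_density_def
      using mult_mono[of "1 / sqrt (2 * pi)" 1 "exp (- z\<^sup>2 / 2)" 1] by simp
  qed
  have L1: "L \<longlonglongrightarrow> (LINT \<xi>|lborel. cis (x * \<xi>) * complex_of_real (1 / sqrt (2 * pi)) * fourier f \<xi>)"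
    unfolding L_def
  proof (rule integral_dominated_convergence[where w = "\<lambda>\<xi>. norm (fourier f \<xi>)"])
    show "AE \<xi> in lborel. (\<lambda>n. cis (x * \<xi>) * complex_of_real (std_normal_density (e n * \<xi>)) * fourier f \<xi>)
      \<longlonglongrightarrow> cis (x * \<xi>) * complex_of_real (1 / sqrt (2 * pi)) * fourier f \<xi>"
      by (intro AE_I2 tendsto_intros tendsto_std_normal_density_0 e)
    show "AE \<xi> in lborel. norm (cis (x * \<xi>) * complex_of_real (std_normal_density (e n * \<xi>)) * fourier f \<xi>)
       \<le> norm (fourier f \<xi>)" for n
      using std1 by (auto simp: norm_mult intro!: mult_left_le_one_le)
  qed (use F in auto)
  have L_eq: "L n = (LINT z|lborel. f (x + e n * z) * complex_of_real (sqrt (2 * pi) * std_normal_density z))" for n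
  proof -
    have "L n = (LINT y|lborel. f y * complex_of_real (exp (- ((x - y) / e n)\<^sup>2 / 2) / e n))"
      unfolding L_def by (rule fourier_gauss_mean[OF f e(2)])
    also have "\<dots> = e n *\<^sub>R (LINT z|lborel. f (x + e n * z) * complex_of_real (exp (- ((x - (x + e n * z)) / e n)\<^sup>2 / 2) / e n))"
      using e(2)[of n] by (subst lborel_integral_real_affine[where t = x and c = "e n"]) auto
    also have "\<dots> = (LINT z|lborel. f (x + e n * z) * complex_of_real (sqrt (2 * pi) * std_normal_density z))"
      using e(2)[of n]
      by (subst integral_scaleR_right[symmetric], intro Bochner_Integration.integral_cong refl)
        (auto simp: std_normal_density_def scaleR_conv_of_real)
    finally show ?thesis .
  qed
  have L2: "L \<longlonglongrightarrow> (LINT z|lborel. f x * complex_of_real (sqrt (2 * pi) * std_normal_density z))"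
    unfolding L_eq
  proof (rule integral_dominated_convergence[where w = "\<lambda>z. B * (sqrt (2 * pi) * std_normal_density z)"])
    have "isCont f x" using cont by (simp add: continuous_on_eq_continuous_at)
    moreover have "(\<lambda>n. x + e n * z) \<longlonglongrightarrow> x + 0 * z" for z by (intro tendsto_intros e)
    ultimately have "(\<lambda>n. f (x + e n * z)) \<longlonglongrightarrow> f x" for z
      by (auto intro: isCont_tendsto_compose)
    then show "AE z in lborel. (\<lambda>n. f (x + e n * z) * complex_of_real (sqrt (2 * pi) * std_normal_density z))
       \<longlonglongrightarrow> f x * complex_of_real (sqrt (2 * pi) * std_normal_density z)"
      by (intro AE_I2 tendsto_intros)
    show "AE z in lborel. norm (f (x + e n * z) * complex_of_real (sqrt (2 * pi) * std_normal_density z))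
       \<le> B * (sqrt (2 * pi) * std_normal_density z)" for n
      by (auto simp: norm_mult abs_mult intro!: mult_right_mono bd)
  qed auto
  have "(LINT z|lborel. f x * complex_of_real (sqrt (2 * pi) * std_normal_density z)) = f x * complex_of_real (sqrt (2 * pi))"
    by (simp only: integral_mult_right_zero integral_complex_of_real) simp
  with LIMSEQ_unique[OF L1 L2]
  have "(LINT \<xi>|lborel. cis (x * \<xi>) * complex_of_real (1 / sqrt (2 * pi)) * fourier f \<xi>) = f x * complex_of_real (sqrt (2 * pi))"
    by simp
  moreover have "(LINT \<xi>|lborel. cis (x * \<xi>) * complex_of_real (1 / sqrt (2 * pi)) * fourier f \<xi>)
     = complex_of_real (1 / sqrt (2 * pi)) * (LINT \<xi>|lborel. cis (x * \<xi>) * fourier f \<xi>)"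
    by (subst integral_mult_right_zero[symmetric]) (simp add: mult_ac)
  ultimately have "complex_of_real (1 / sqrt (2 * pi)) * (LINT \<xi>|lborel. cis (x * \<xi>) * fourier f \<xi>) = f x * complex_of_real (sqrt (2 * pi))"
    by simp
  then have "(LINT \<xi>|lborel. cis (x * \<xi>) * fourier f \<xi>) = f x * complex_of_real (sqrt (2 * pi) * sqrt (2 * pi))"
    unfolding of_real_mult by (simp only: of_real_divide) (simp add: field_simps del: real_sqrt_mult_self)
  then show ?thesis unfolding inverse_fourier_def by simp
qed

section \<open>The Japanese bracket\<close>

lemma japanese_ge_1: "1 \<le> japanese x"
  unfolding japanese_def by simp

lemma japanese_pos [simp]: "0 < japanese x"
  using japanese_ge_1[of x] by linarith

lemma japanese_nonneg [simp]: "0 \<le> japanese x"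
  using japanese_pos[of x] by linarith

lemma japanese_nonzero [simp]: "japanese x \<noteq> 0"
  using japanese_pos[of x] by linarith

lemma abs_le_japanese: "\<bar>x\<bar> \<le> japanese x"
  unfolding japanese_def by (rule real_le_rsqrt) simp

lemma japanese_minus [simp]: "japanese (- x) = japanese x"
  by (simp add: japanese_def)

lemma japanese_power2: "(japanese x)\<^sup>2 = 1 + x\<^sup>2"
  by (simp add: japanese_def)

lemma japanese_le_1_plus_abs: "japanese x \<le> 1 + \<bar>x\<bar>"
  by (rule power2_le_imp_le) (auto simp: japanese_power2 power2_sum)

lemma japanese_powr_minus_2: "japanese x powr (- 2) = 1 / (1 + x\<^sup>2)"
proof -
  have "japanese x powr (- 2) = inverse (japanese x powr (real 2))"
    by (simp add: powr_minus)
  also have "japanese x powr (real 2) = (japanese x)\<^sup>2" by (rule powr_realpow) simp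
  finally show ?thesis by (simp add: japanese_power2 divide_inverse)
qed

lemma continuous_on_japanese [continuous_intros]:
  "continuous_on A f \<Longrightarrow> continuous_on A (\<lambda>x. japanese (f x))"
  unfolding japanese_def by (intro continuous_intros)

lemma measurable_japanese [measurable]: "japanese \<in> borel_measurable borel"
  by (intro borel_measurable_continuous_onI continuous_intros)

lemma has_real_derivative_japanese:
  "(japanese has_real_derivative x / japanese x) (at x)"
  unfolding japanese_def[abs_def]
proof -
  have "0 < 1 + x\<^sup>2" by (simp add: add_pos_nonneg)
  then show "((\<lambda>x. sqrt (1 + x\<^sup>2)) has_real_derivative x / sqrt (1 + x\<^sup>2)) (at x)"
    by (auto intro!: derivative_eq_intros simp: divide_simps)
qed

lemma integrable_indicator_nonneg_has_integral:
  fixes f :: "real \<Rightarrow> real"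
  assumes "(f has_integral I) A" "\<And>x. x \<in> A \<Longrightarrow> 0 \<le> f x"
    and [measurable]: "f \<in> borel_measurable borel" "A \<in> sets borel"
  shows "integrable lborel (\<lambda>x. indicator A x * f x)"
proof -
  have "f absolutely_integrable_on A"
    using assms by (intro nonnegative_absolutely_integrable_1) (auto simp: integrable_on_def)
  then have "integrable lebesgue (\<lambda>x. indicator A x * f x)"
    by (simp add: set_integrable_def)
  then show ?thesis by (subst (asm) integrable_completion) auto
qed

text \<open>
  The two exponents separate the two conditions: \<open>\<beta> > -1\<close> is integrability at 0 and
  \<open>p > \<beta> + 1\<close> is integrability at infinity.
\<close>

lemma integrable_powr_japanese:
  assumes beta: "\<beta> > -1" and p: "p > \<beta> + 1"
  shows "integrable lborel (\<lambda>z. \<bar>z\<bar> powr \<beta> * japanese z powr (- p))"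
proof -
  define F where "F z = indicator {0..1} z * z powr \<beta> + indicator {1..} z * z powr (\<beta> - p)" for z :: real
  have F: "integrable lborel F" unfolding F_def[abs_def]
  proof (rule Bochner_Integration.integrable_add)
    show "integrable lborel (\<lambda>z. indicator {0..1} z * z powr \<beta>)"
      by (rule integrable_indicator_nonneg_has_integral[OF has_integral_powr_from_0[of \<beta> 1]]) (use beta in auto)
    show "integrable lborel (\<lambda>z. indicator {1..} z * z powr (\<beta> - p))"
      by (rule integrable_indicator_nonneg_has_integral[OF has_integral_powr_to_inf[of "\<beta> - p" 1]]) (use p in auto)
  qed
  have F': "integrable lborel (\<lambda>z. F (- z))"
    using lborel_integrable_real_affine[OF F, of "-1" 0] by simp
  have pos: "\<bar>z\<bar> powr \<beta> * japanese z powr (- p) \<le> F z" if "z \<ge> 0" for z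
  proof (cases "z \<le> 1")
    case True
    have "japanese z powr (- p) \<le> 1 powr (- p)"
      by (rule powr_mono2') (use p beta japanese_ge_1 in auto)
    then have "z powr \<beta> * japanese z powr (- p) \<le> z powr \<beta>"
      by (simp add: mult_left_le)
    with True that show ?thesis by (auto simp: F_def indicator_def)
  next
    case False
    have "japanese z powr (- p) \<le> z powr (- p)"
      by (rule powr_mono2') (use p beta False abs_le_japanese[of z] in auto)
    then have "z powr \<beta> * japanese z powr (- p) \<le> z powr \<beta> * z powr (- p)"
      by (rule mult_left_mono) simp
    with False show ?thesis by (simp add: F_def powr_add[symmetric])
  qed
  have F0: "F z \<ge> 0" for z by (simp add: F_def)
  have "\<bar>z\<bar> powr \<beta> * japanese z powr (- p) \<le> F z + F (- z)" for z
    using pos[of z] pos[of "- z"] F0[of z] F0[of "-z"] by (cases "z \<ge> 0") auto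
  then show ?thesis
    by (intro Bochner_Integration.integrable_bound[OF Bochner_Integration.integrable_add[OF F F']])
       (auto simp: F0)
qed

lemma integrable_japanese_powr:
  assumes "e > 1"
  shows "integrable lborel (\<lambda>z. japanese z powr (- e))"
proof -
  have "integrable lborel (\<lambda>z. \<bar>z\<bar> powr 0 * japanese z powr (- e))"
    using assms by (intro integrable_powr_japanese) auto
  moreover have "AE z in lborel. \<bar>z\<bar> powr 0 * japanese z powr (- e) = japanese z powr (- e)"
    using AE_lborel_singleton[of "0::real"] by eventually_elim simp
  ultimately show ?thesis by (subst (asm) integrable_cong_AE) auto
qed

lemma tendsto_japanese_powr:
  assumes "e > 0"
  shows "((\<lambda>x. japanese x powr (- e)) \<longlongrightarrow> 0) at_top" "((\<lambda>x. japanese x powr (- e)) \<longlongrightarrow> 0) at_bot"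
proof -
  have top: "filterlim japanese at_top at_top"
    by (rule filterlim_at_top_mono[OF filterlim_ident])
       (auto intro!: always_eventually order_trans[OF abs_ge_self abs_le_japanese])
  show 1: "((\<lambda>x. japanese x powr (- e)) \<longlongrightarrow> 0) at_top"
    by (rule tendsto_neg_powr) (use assms top in auto)
  show "((\<lambda>x. japanese x powr (- e)) \<longlongrightarrow> 0) at_bot"
    unfolding at_bot_mirror filterlim_filtermap using 1 by simp
qed

section \<open>Decay of Fourier transforms of smooth functions\<close>

lemma norm_cis_minus_one_le: "norm (cis t - 1) \<le> \<bar>t\<bar>"
  using iexp_approx1[of t 0] by (simp add: cis_conv_exp)

lemma norm_cis_taylor: "norm (cis t - 1 - \<i> * t) \<le> t\<^sup>2 / 2"
  using iexp_approx1[of t 1] by (simp add: cis_conv_exp power2_eq_square diff_diff_eq)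

text \<open>
  A class of functions that is closed under differentiation and whose members decay at one common rate
  (with constants that may differ).  Schwartz functions and the derivatives of the weight are both covered, and
  inductions over repeated differentiation need no sequence of derivatives.
\<close>

definition decaying_class :: "real \<Rightarrow> ((real \<Rightarrow> complex) \<Rightarrow> bool) \<Rightarrow> bool" where
  "decaying_class e P \<longleftrightarrow> (\<forall>f. P f \<longrightarrow>
     (\<exists>f'. P f' \<and> (\<forall>x. (f has_vector_derivative f' x) (at x))) \<and>
     (\<exists>C. \<forall>x. norm (f x) \<le> C * japanese x powr (- e)))"

context
  fixes e :: real and P :: "(real \<Rightarrow> complex) \<Rightarrow> bool"
  assumes cls: "decaying_class e P" and e1: "e > 1"
begin

lemma decaying_bound:
  assumes "P f" obtains C where "C \<ge> 0" "\<And>x. norm (f x) \<le> C * japanese x powr (- e)"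
proof -
  obtain C where C: "\<And>x. norm (f x) \<le> C * japanese x powr (- e)"
    using cls assms unfolding decaying_class_def by blast
  have "0 \<le> C * japanese 0 powr (- e)" by (rule order_trans[OF norm_ge_zero C])
  then have "C \<ge> 0" by (simp add: zero_le_mult_iff japanese_def)
  with C that show ?thesis by blast
qed

lemma decaying_derivative:
  assumes "P f" obtains f' where "P f'" "\<And>x. (f has_vector_derivative f' x) (at x)"
  using cls assms unfolding decaying_class_def by blast

lemma decaying_continuous:
  assumes "P f" shows "continuous_on UNIV f"
proof -
  obtain f' where "\<And>x. (f has_vector_derivative f' x) (at x)" using decaying_derivative[OF assms] by blast
  then show ?thesis
    by (intro continuous_at_imp_continuous_on ballI) (auto intro: has_vector_derivative_continuous)
qed

lemma decaying_measurable: "P f \<Longrightarrow> f \<in> borel_measurable borel"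
  by (rule borel_measurable_continuous_onI) (rule decaying_continuous)

lemma decaying_integrable:
  assumes "P f" shows "integrable lborel f"
proof -
  obtain C where C: "C \<ge> 0" "\<And>x. norm (f x) \<le> C * japanese x powr (- e)" using decaying_bound[OF assms] by blast
  show ?thesis
    by (rule Bochner_Integration.integrable_bound[OF integrable_mult_right[OF integrable_japanese_powr[OF e1], of C]])
      (use C decaying_measurable[OF assms] in auto)
qed

lemma fourier_derivative:
  assumes f: "P f" and f': "P f'" and deriv: "\<And>x. (f has_vector_derivative f' x) (at x)"
  shows "fourier f' \<xi> = \<i> * \<xi> * fourier f \<xi>"
proof -
  define E where "E x = cis (- (x * \<xi>))" for x
  have dE: "(E has_vector_derivative (- \<i> * \<xi> * E x)) (at x)" for x
    using exp_scaleR_has_vector_derivative_right[of "- \<i> * \<xi>" x UNIV]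
    by (simp add: E_def[abs_def] cis_conv_exp scaleR_conv_of_real mult_ac)
  have int: "integrable lborel (\<lambda>x. E x * f x)" "integrable lborel (\<lambda>x. E x * f' x)"
    unfolding E_def by (intro integrable_cis_mult decaying_integrable f f'; simp)+
  define d where "d x = E x * f' x + (- \<i> * \<xi>) * (E x * f x)" for x
  have intd: "integrable lborel d" unfolding d_def[abs_def] using int by auto
  have dd: "((\<lambda>x. E x * f x) has_vector_derivative d x) (at x)" for x
    using has_vector_derivative_mult[OF dE deriv] by (simp add: d_def mult_ac)
  obtain C where C: "C \<ge> 0" "\<And>x. norm (f x) \<le> C * japanese x powr (- e)" using decaying_bound[OF f] by blast
  have lim: "((\<lambda>x. E x * f x) \<longlongrightarrow> 0) F" if "((\<lambda>x. japanese x powr (- e)) \<longlongrightarrow> 0) F" for F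
    by (rule Lim_null_comparison[OF _ tendsto_mult_right_zero[OF that, of C]])
       (use C in \<open>auto simp: norm_mult E_def\<close>)
  have contE: "isCont E x" "isCont f x" "isCont f' x" for x
    using decaying_continuous[OF f] decaying_continuous[OF f'] dE[of x]
    by (auto simp: continuous_on_eq_continuous_at intro: has_vector_derivative_continuous)
  have "(LBINT x=-\<infinity>..\<infinity>. d x) = 0 - 0"
  proof (rule interval_integral_FTC_integrable[where F = "\<lambda>x. E x * f x"])
    show "isCont d x" for x unfolding d_def by (intro continuous_intros contE)
    show "set_integrable lborel (einterval (- \<infinity>) \<infinity>) d" using intd by (simp add: set_integrable_def)
    show "(((\<lambda>x. E x * f x) \<circ> real_of_ereal) \<longlongrightarrow> 0) (at_right (-\<infinity>))"
      using lim[OF tendsto_japanese_powr(2)] e1 by (auto simp: ereal_tendsto_simps)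
    show "(((\<lambda>x. E x * f x) \<circ> real_of_ereal) \<longlongrightarrow> 0) (at_left \<infinity>)"
      using lim[OF tendsto_japanese_powr(1)] e1 by (auto simp: ereal_tendsto_simps)
  qed (use dd in auto)
  then have "(LINT x|lborel. d x) = 0"
    by (simp add: interval_lebesgue_integral_def set_lebesgue_integral_def)
  moreover have "(LINT x|lborel. d x) = fourier f' \<xi> + (- \<i> * \<xi>) * fourier f \<xi>"
    unfolding d_def fourier_def E_def[symmetric] using int by (subst Bochner_Integration.integral_add) auto
  ultimately show ?thesis by simp
qed

text \<open>
  Integration by parts gives \<open>|\<xi>| |fourier f \<xi>| = |fourier f' \<xi>|\<close>, and \<open>f'\<close> is in the class again.
\<close>

lemma fourier_decay:
  "P f \<Longrightarrow> \<exists>C\<ge>0. \<forall>\<xi>. (1 + \<bar>\<xi>\<bar>) ^ n * norm (fourier f \<xi>) \<le> C"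
proof (induction n arbitrary: f)
  case 0
  show ?case using norm_fourier_le[of f] by (intro exI[of _ "LINT x|lborel. norm (f x)"]) auto
next
  case (Suc n)
  obtain f' where f': "P f'" "\<And>x. (f has_vector_derivative f' x) (at x)" using decaying_derivative[OF Suc.prems] by blast
  obtain C where C: "C \<ge> 0" "\<And>\<xi>. (1 + \<bar>\<xi>\<bar>) ^ n * norm (fourier f \<xi>) \<le> C" using Suc.IH[OF Suc.prems] by auto
  obtain C' where C': "C' \<ge> 0" "\<And>\<xi>. (1 + \<bar>\<xi>\<bar>) ^ n * norm (fourier f' \<xi>) \<le> C'" using Suc.IH[OF f'(1)] by auto
  have "(1 + \<bar>\<xi>\<bar>) ^ Suc n * norm (fourier f \<xi>) \<le> C + C'" for \<xi>
  proof -
    have "norm (fourier f' \<xi>) = \<bar>\<xi>\<bar> * norm (fourier f \<xi>)"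
      by (simp add: fourier_derivative[OF Suc.prems f'] norm_mult)
    then have "(1 + \<bar>\<xi>\<bar>) ^ Suc n * norm (fourier f \<xi>) = (1 + \<bar>\<xi>\<bar>) ^ n * norm (fourier f \<xi>) + (1 + \<bar>\<xi>\<bar>) ^ n * norm (fourier f' \<xi>)"
      by (simp add: algebra_simps)
    with C(2)[of \<xi>] C'(2)[of \<xi>] show ?thesis by simp
  qed
  with C C' show ?case by (intro exI[of _ "C + C'"]) auto
qed

text \<open>
  For \<open>n = 0\<close> this is \<open>|cis (x h) - 1| \<le> |x h|\<close>, where \<open>e > 2\<close> makes
  \<open>|x| |f x|\<close> integrable.  With \<open>\<Delta> f \<xi> = fourier f (\<xi> - h) - fourier f \<xi>\<close>,
  integration by parts gives
  \<open>\<i> \<xi> \<Delta> f \<xi> = \<Delta> f' \<xi> + \<i> h fourier f (\<xi> - h)\<close>,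
  which adds one power of \<open>|\<xi>|\<close> on the left while every term on the right keeps the factor \<open>h\<close>.
\<close>

lemma fourier_difference_decay:
  assumes e2: "e > 2"
  shows "P f \<Longrightarrow> \<exists>C\<ge>0. \<forall>\<xi> h. (1 + \<bar>\<xi>\<bar>) ^ n * norm (fourier f (\<xi> - h) - fourier f \<xi>) \<le> C * (\<bar>h\<bar> * (1 + \<bar>h\<bar>) ^ n)"
proof (induction n arbitrary: f)
  case 0
  note [measurable] = decaying_measurable[OF 0]
  obtain C where C: "C \<ge> 0" "\<And>x. norm (f x) \<le> C * japanese x powr (- e)" using decaying_bound[OF 0] by blast
  have "norm (\<bar>x\<bar> * norm (f x)) \<le> norm (C * japanese x powr (- (e - 1)))" for x
  proof -
    have "\<bar>x\<bar> * norm (f x) \<le> japanese x * (C * japanese x powr (- e))"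
      using C abs_le_japanese by (intro mult_mono) auto
    also have "\<dots> = C * (japanese x powr 1 * japanese x powr (- e))" by simp
    also have "\<dots> = C * japanese x powr (- (e - 1))" unfolding powr_add[symmetric] by simp
    finally show ?thesis using C by simp
  qed
  then have int: "integrable lborel (\<lambda>x. \<bar>x\<bar> * norm (f x))"
    using e2 by (intro Bochner_Integration.integrable_bound[OF integrable_mult_right[OF integrable_japanese_powr[of "e - 1"], of C]]) auto
  define M where "M = (LINT x|lborel. \<bar>x\<bar> * norm (f x))"
  have "norm (fourier f (\<xi> - h) - fourier f \<xi>) \<le> M * \<bar>h\<bar>" for \<xi> h
  proof -
    have "fourier f (\<xi> - h) - fourier f \<xi> = (LINT x|lborel. cis (- (x * (\<xi> - h))) * f x - cis (- (x * \<xi>)) * f x)"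
      unfolding fourier_def
      by (intro Bochner_Integration.integral_diff[symmetric] integrable_cis_mult decaying_integrable 0; simp)
    also have "norm \<dots> \<le> (LINT x|lborel. \<bar>h\<bar> * (\<bar>x\<bar> * norm (f x)))"
    proof (rule Bochner_Integration.integral_norm_bound_integral)
      fix x
      have "cis (- (x * (\<xi> - h))) = cis (- (x * \<xi>)) * cis (x * h)" by (simp add: cis_mult algebra_simps)
      then have "cis (- (x * (\<xi> - h))) * f x - cis (- (x * \<xi>)) * f x = cis (- (x * \<xi>)) * (cis (x * h) - 1) * f x"
        by (simp add: algebra_simps)
      then have "norm (cis (- (x * (\<xi> - h))) * f x - cis (- (x * \<xi>)) * f x) = norm (cis (x * h) - 1) * norm (f x)"
        by (simp add: norm_mult)
      also have "\<dots> \<le> \<bar>x * h\<bar> * norm (f x)" by (intro mult_right_mono norm_cis_minus_one_le) simp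
      finally show "norm (cis (- (x * (\<xi> - h))) * f x - cis (- (x * \<xi>)) * f x) \<le> \<bar>h\<bar> * (\<bar>x\<bar> * norm (f x))"
        by (simp add: abs_mult mult_ac)
    qed (use int in \<open>auto intro!: Bochner_Integration.integrable_diff integrable_cis_mult decaying_integrable[OF 0]\<close>)
    finally show ?thesis unfolding M_def by (subst (asm) integral_mult_right_zero) (simp add: mult.commute)
  qed
  moreover have "M \<ge> 0" unfolding M_def by simp
  ultimately show ?case by (intro exI[of _ M]) auto
next
  case (Suc n)
  obtain f' where f': "P f'" "\<And>x. (f has_vector_derivative f' x) (at x)" using decaying_derivative[OF Suc.prems] by blast
  define \<Delta> where "\<Delta> f \<xi> h = fourier f (\<xi> - h) - fourier f \<xi>" for f \<xi> h
  obtain C where C: "C \<ge> 0" "\<And>\<xi> h. (1 + \<bar>\<xi>\<bar>) ^ n * norm (\<Delta> f \<xi> h) \<le> C * (\<bar>h\<bar> * (1 + \<bar>h\<bar>) ^ n)"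
    using Suc.IH[OF Suc.prems] unfolding \<Delta>_def by blast
  obtain C' where C': "C' \<ge> 0" "\<And>\<xi> h. (1 + \<bar>\<xi>\<bar>) ^ n * norm (\<Delta> f' \<xi> h) \<le> C' * (\<bar>h\<bar> * (1 + \<bar>h\<bar>) ^ n)"
    using Suc.IH[OF f'(1)] unfolding \<Delta>_def by blast
  obtain D where D: "D \<ge> 0" "\<And>\<xi>. (1 + \<bar>\<xi>\<bar>) ^ n * norm (fourier f \<xi>) \<le> D"
    using fourier_decay[OF Suc.prems] by blast
  have "(1 + \<bar>\<xi>\<bar>) ^ Suc n * norm (\<Delta> f \<xi> h) \<le> (C + C' + D) * (\<bar>h\<bar> * (1 + \<bar>h\<bar>) ^ Suc n)" for \<xi> h
  proof -
    have "\<i> * \<xi> * \<Delta> f \<xi> h = \<Delta> f' \<xi> h + \<i> * h * fourier f (\<xi> - h)"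
      unfolding \<Delta>_def fourier_derivative[OF Suc.prems f'] by (simp add: algebra_simps)
    then have "norm (\<i> * \<xi> * \<Delta> f \<xi> h) \<le> norm (\<Delta> f' \<xi> h) + norm (\<i> * h * fourier f (\<xi> - h))"
      by (simp only: norm_triangle_ineq)
    then have 1: "\<bar>\<xi>\<bar> * norm (\<Delta> f \<xi> h) \<le> norm (\<Delta> f' \<xi> h) + \<bar>h\<bar> * norm (fourier f (\<xi> - h))"
      by (simp add: norm_mult)
    have "(1 + \<bar>\<xi>\<bar>) \<le> (1 + \<bar>h\<bar>) * (1 + \<bar>\<xi> - h\<bar>)"
    proof -
      have "\<bar>\<xi>\<bar> \<le> \<bar>h\<bar> + \<bar>\<xi> - h\<bar>" by linarith
      moreover have "0 \<le> \<bar>h\<bar> * \<bar>\<xi> - h\<bar>" by simp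
      moreover have "(1 + \<bar>h\<bar>) * (1 + \<bar>\<xi> - h\<bar>) = 1 + \<bar>h\<bar> + \<bar>\<xi> - h\<bar> + \<bar>h\<bar> * \<bar>\<xi> - h\<bar>"
        by (simp add: algebra_simps)
      ultimately show ?thesis by linarith
    qed
    then have "(1 + \<bar>\<xi>\<bar>) ^ n \<le> (1 + \<bar>h\<bar>) ^ n * (1 + \<bar>\<xi> - h\<bar>) ^ n"
      unfolding power_mult_distrib[symmetric] by (rule power_mono) simp
    then have "(1 + \<bar>\<xi>\<bar>) ^ n * norm (fourier f (\<xi> - h)) \<le> (1 + \<bar>h\<bar>) ^ n * ((1 + \<bar>\<xi> - h\<bar>) ^ n * norm (fourier f (\<xi> - h)))"
      by (metis mult.assoc mult_right_mono norm_ge_zero)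
    also have "\<dots> \<le> (1 + \<bar>h\<bar>) ^ n * D" by (intro mult_left_mono D) simp
    finally have 2: "(1 + \<bar>\<xi>\<bar>) ^ n * norm (fourier f (\<xi> - h)) \<le> (1 + \<bar>h\<bar>) ^ n * D" .
    have "(1 + \<bar>\<xi>\<bar>) ^ Suc n * norm (\<Delta> f \<xi> h)
        = (1 + \<bar>\<xi>\<bar>) ^ n * norm (\<Delta> f \<xi> h) + (1 + \<bar>\<xi>\<bar>) ^ n * (\<bar>\<xi>\<bar> * norm (\<Delta> f \<xi> h))"
      by (simp add: algebra_simps)
    also have "\<dots> \<le> (1 + \<bar>\<xi>\<bar>) ^ n * norm (\<Delta> f \<xi> h) + (1 + \<bar>\<xi>\<bar>) ^ n * (norm (\<Delta> f' \<xi> h) + \<bar>h\<bar> * norm (fourier f (\<xi> - h)))"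
      by (intro add_left_mono mult_left_mono 1) simp
    also have "\<dots> = (1 + \<bar>\<xi>\<bar>) ^ n * norm (\<Delta> f \<xi> h) + (1 + \<bar>\<xi>\<bar>) ^ n * norm (\<Delta> f' \<xi> h) + \<bar>h\<bar> * ((1 + \<bar>\<xi>\<bar>) ^ n * norm (fourier f (\<xi> - h)))"
      by (simp add: algebra_simps)
    also have "\<dots> \<le> C * (\<bar>h\<bar> * (1 + \<bar>h\<bar>) ^ n) + C' * (\<bar>h\<bar> * (1 + \<bar>h\<bar>) ^ n) + \<bar>h\<bar> * ((1 + \<bar>h\<bar>) ^ n * D)"
      by (intro add_mono C C' mult_left_mono 2) simp
    also have "\<dots> = (C + C' + D) * (\<bar>h\<bar> * (1 + \<bar>h\<bar>) ^ n)" by (simp add: algebra_simps)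
    also have "\<dots> \<le> (C + C' + D) * (\<bar>h\<bar> * (1 + \<bar>h\<bar>) ^ Suc n)"
      using C C' D by (intro mult_left_mono power_increasing) auto
    finally show ?thesis .
  qed
  with C C' D show ?case unfolding \<Delta>_def by (intro exI[of _ "C + C' + D"]) auto
qed

end

section \<open>Functions whose derivative has an integrable Fourier transform\<close>

text \<open>
  At \<open>\<zeta> = 0\<close> the quotient is 0 by the convention on division.
\<close>

lemma norm_divide_frequency_le:
  "norm (z / (2 * pi * \<i> * complex_of_real \<zeta>)) * \<bar>\<zeta>\<bar> \<le> norm z"
proof (cases "\<zeta> = 0")
  case False
  have "1 * norm z \<le> (2 * pi) * norm z" using pi_gt3 by (intro mult_right_mono) auto
  with False show ?thesis by (simp add: norm_mult norm_divide field_simps)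
qed simp

text \<open>
  Subtracting 1 from \<open>cis (x \<zeta>)\<close> cancels the pole of \<open>H\<close> at 0.  The right-hand side can be
  differentiated with a quadratic error, because \<open>\<zeta>\<^sup>2 H \<zeta>\<close> is integrable, and its derivative is the
  inverse transform of \<open>G\<close>, that is \<open>q'\<close>.
\<close>

lemma antiderivative_fourier_representation:
  fixes q :: "real \<Rightarrow> real"
  assumes q: "\<And>x. (q has_real_derivative q' x) (at x)"
    and G: "\<And>x. inverse_fourier G x = complex_of_real (q' x)"
    and Gi: "integrable lborel (\<lambda>\<zeta>. (1 + \<bar>\<zeta>\<bar>) * norm (G \<zeta>))"
    and [measurable]: "G \<in> borel_measurable borel"
  defines "H \<equiv> \<lambda>\<zeta>. G \<zeta> / (2 * pi * \<i> * \<zeta>)"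
  shows "complex_of_real (q x) = q 0 + (LINT \<zeta>|lborel. (cis (x * \<zeta>) - 1) * H \<zeta>)"
proof -
  have Hm [measurable]: "H \<in> borel_measurable borel" unfolding H_def by measurable
  have nH: "norm (H \<zeta>) * \<bar>\<zeta>\<bar> \<le> norm (G \<zeta>)" for \<zeta>
    unfolding H_def by (rule norm_divide_frequency_le)
  have GI: "integrable lborel (\<lambda>\<zeta>. norm (G \<zeta>))" "integrable lborel (\<lambda>\<zeta>. \<bar>\<zeta>\<bar> * norm (G \<zeta>))"
    by (rule Bochner_Integration.integrable_bound[OF Gi]; auto simp: algebra_simps)+
  define R where "R x = (LINT \<zeta>|lborel. (cis (x * \<zeta>) - 1) * H \<zeta>)" for x
  have Rint: "integrable lborel (\<lambda>\<zeta>. (cis (x * \<zeta>) - 1) * H \<zeta>)" for x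
  proof (rule Bochner_Integration.integrable_bound[OF integrable_mult_right[OF GI(1), of "\<bar>x\<bar>"]])
    show "AE \<zeta> in lborel. norm ((cis (x * \<zeta>) - 1) * H \<zeta>) \<le> norm (\<bar>x\<bar> * norm (G \<zeta>))"
    proof (rule AE_I2)
      fix \<zeta>
      have "norm ((cis (x * \<zeta>) - 1) * H \<zeta>) \<le> \<bar>x * \<zeta>\<bar> * norm (H \<zeta>)"
        unfolding norm_mult by (intro mult_right_mono norm_cis_minus_one_le) simp
      also have "\<dots> \<le> \<bar>x\<bar> * norm (G \<zeta>)"
        using mult_left_mono[OF nH[of \<zeta>], of "\<bar>x\<bar>"] by (simp add: abs_mult mult_ac)
      finally show "norm ((cis (x * \<zeta>) - 1) * H \<zeta>) \<le> norm (\<bar>x\<bar> * norm (G \<zeta>))" by simp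
    qed
  qed measurable
  define D where "D x \<zeta> = cis (x * \<zeta>) * (\<i> * \<zeta>) * H \<zeta>" for x \<zeta>
  have Dint: "integrable lborel (D x)" for x
    by (rule Bochner_Integration.integrable_bound[OF GI(1)])
       (use nH in \<open>auto simp: D_def[abs_def] norm_mult mult.commute\<close>)
  have Dval: "(LINT \<zeta>|lborel. D x \<zeta>) = q' x" for x
  proof -
    have "(LINT \<zeta>|lborel. D x \<zeta>) = (LINT \<zeta>|lborel. cis (x * \<zeta>) * G \<zeta> / complex_of_real (2 * pi))"
    proof (rule integral_cong_AE)
      show "AE \<zeta> in lborel. D x \<zeta> = cis (x * \<zeta>) * G \<zeta> / complex_of_real (2 * pi)"
        using AE_lborel_singleton[of "0::real"]
        by eventually_elim (simp add: D_def H_def)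
    qed (auto simp: D_def[abs_def])
    also have "\<dots> = inverse_fourier G x" unfolding inverse_fourier_def by simp
    finally show ?thesis by (simp add: G)
  qed
  define M where "M = (LINT \<zeta>|lborel. \<bar>\<zeta>\<bar> * norm (G \<zeta>))"
  have quad: "norm (R y - R x - (y - x) *\<^sub>R complex_of_real (q' x)) \<le> M * (y - x)\<^sup>2" for x y
  proof -
    have "R y - R x - (y - x) *\<^sub>R complex_of_real (q' x)
       = (LINT \<zeta>|lborel. (cis (y * \<zeta>) - 1) * H \<zeta> - (cis (x * \<zeta>) - 1) * H \<zeta> - (y - x) *\<^sub>R D x \<zeta>)"
      unfolding R_def Dval[symmetric] using Rint Dint by simp
    also have "norm \<dots> \<le> (LINT \<zeta>|lborel. (y - x)\<^sup>2 * (\<bar>\<zeta>\<bar> * norm (G \<zeta>)))"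
    proof (rule Bochner_Integration.integral_norm_bound_integral)
      fix \<zeta>
      have "cis (y * \<zeta>) = cis (x * \<zeta>) * cis ((y - x) * \<zeta>)" by (simp add: cis_mult algebra_simps)
      then have "(cis (y * \<zeta>) - 1) * H \<zeta> - (cis (x * \<zeta>) - 1) * H \<zeta> - (y - x) *\<^sub>R D x \<zeta>
        = cis (x * \<zeta>) * (cis ((y - x) * \<zeta>) - 1 - \<i> * complex_of_real ((y - x) * \<zeta>)) * H \<zeta>"
        unfolding D_def scaleR_conv_of_real by (simp add: algebra_simps)
      then have "norm ((cis (y * \<zeta>) - 1) * H \<zeta> - (cis (x * \<zeta>) - 1) * H \<zeta> - (y - x) *\<^sub>R D x \<zeta>)
        = norm (cis ((y - x) * \<zeta>) - 1 - \<i> * complex_of_real ((y - x) * \<zeta>)) * norm (H \<zeta>)"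
        by (simp add: norm_mult)
      also have "\<dots> \<le> ((y - x) * \<zeta>)\<^sup>2 / 2 * norm (H \<zeta>)"
        by (intro mult_right_mono norm_cis_taylor) simp
      also have "\<dots> \<le> ((y - x) * \<zeta>)\<^sup>2 * norm (H \<zeta>)" by simp
      also have "\<dots> = ((y - x)\<^sup>2 * \<bar>\<zeta>\<bar>) * (norm (H \<zeta>) * \<bar>\<zeta>\<bar>)"
        by (simp add: power2_eq_square)
      also have "\<dots> \<le> ((y - x)\<^sup>2 * \<bar>\<zeta>\<bar>) * norm (G \<zeta>)" by (intro mult_left_mono nH) simp
      finally show "norm ((cis (y * \<zeta>) - 1) * H \<zeta> - (cis (x * \<zeta>) - 1) * H \<zeta> - (y - x) *\<^sub>R D x \<zeta>)
         \<le> (y - x)\<^sup>2 * (\<bar>\<zeta>\<bar> * norm (G \<zeta>))" by (simp add: mult_ac)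
    qed (use Rint Dint GI in auto)
    finally show ?thesis unfolding M_def by (subst (asm) integral_mult_right_zero) (simp add: mult.commute)
  qed
  have "(R has_vector_derivative complex_of_real (q' x)) (at x)" for x
    unfolding has_vector_derivative_def
  proof (rule has_derivativeI_sandwich[where e = 1])
    show "bounded_linear (\<lambda>t. t *\<^sub>R complex_of_real (q' x))" by (rule bounded_linear_scaleR_left)
    show "norm (R y - R x - (y - x) *\<^sub>R complex_of_real (q' x)) / norm (y - x) \<le> M * \<bar>y - x\<bar>" if "y \<noteq> x" for y
      using quad[of y x] that by (simp add: divide_simps power2_eq_square mult.assoc flip: abs_mult)
    have "((\<lambda>y. M * \<bar>y - x\<bar>) \<longlongrightarrow> M * \<bar>x - x\<bar>) (at x)" by (intro tendsto_intros)
    then show "((\<lambda>y. M * \<bar>y - x\<bar>) \<longlongrightarrow> 0) (at x)" by simp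
  qed simp_all
  moreover have "((\<lambda>x. complex_of_real (q x)) has_vector_derivative complex_of_real (q' x)) (at x)" for x
    using q[of x] by (auto intro!: has_vector_derivative_of_real simp: has_real_derivative_iff_has_vector_derivative)
  ultimately have "((\<lambda>x. complex_of_real (q x) - R x) has_vector_derivative 0) (at x)" for x
    using has_vector_derivative_diff by fastforce
  then obtain c where "\<And>x. complex_of_real (q x) - R x = c"
    using has_vector_derivative_zero_constant[of UNIV "\<lambda>x. complex_of_real (q x) - R x"] by auto
  moreover have "R 0 = 0" by (simp add: R_def)
  ultimately have "complex_of_real (q x) - R x = complex_of_real (q 0) - 0" by metis
  then show ?thesis by (simp add: R_def algebra_simps)
qed

section \<open>The weight\<close>

context
  fixes \<alpha> :: real
  assumes alpha: "0 < \<alpha>"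
begin

definition weight_tail :: "real \<Rightarrow> real" where
  "weight_tail y = (LINT s:{y..}|lborel. 1 / japanese s powr (1 + \<alpha>))"

definition weight_mass :: real where
  "weight_mass = (LINT s|lborel. 1 / japanese s powr (1 + \<alpha>))"

lemma phi_eq: "phi \<alpha> y = weight_tail y / weight_mass"
  by (simp add: phi_def weight_tail_def weight_mass_def divide_inverse mult.commute)

lemma weight_integrable: "integrable lborel (\<lambda>s. 1 / japanese s powr (1 + \<alpha>))"
proof -
  have "integrable lborel (\<lambda>s. japanese s powr (- (1 + \<alpha>)))"
    using alpha by (intro integrable_japanese_powr) simp
  then show ?thesis unfolding powr_minus_divide .
qed

lemma weight_set_integrable: "A \<in> sets borel \<Longrightarrow> set_integrable lborel A (\<lambda>s. 1 / japanese s powr (1 + \<alpha>))"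
  unfolding set_integrable_def by (rule integrable_mult_indicator[OF _ weight_integrable]) simp

lemma weight_continuous: "continuous_on A (\<lambda>s. 1 / japanese s powr (1 + \<alpha>))"
  by (intro continuous_intros) simp_all

lemma weight_tail_diff:
  assumes "a \<le> b"
  shows "weight_tail a - weight_tail b = integral {a..b} (\<lambda>s. 1 / japanese s powr (1 + \<alpha>))"
proof -
  let ?w = "\<lambda>s. 1 / japanese s powr (1 + \<alpha>)"
  have "weight_tail a = (LINT s:{a..<b}|lborel. ?w s) + weight_tail b"
  proof -
    have "{a..} = {a..<b} \<union> {b..}" using assms by auto
    then show ?thesis unfolding weight_tail_def by (simp only:) (rule set_integral_Un; auto intro!: weight_set_integrable)
  qed
  also have "(LINT s:{a..<b}|lborel. ?w s) = (LINT s:{a..b}|lborel. ?w s)"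
    unfolding set_lebesgue_integral_def
    by (rule integral_cong_AE)
       (use AE_lborel_singleton[of b] in \<open>auto simp: indicator_def elim!: eventually_mono\<close>)
  also have "(LINT s:{a..b}|lborel. ?w s) = integral {a..b} ?w"
    by (rule set_borel_integral_eq_integral(2)) (rule weight_set_integrable, simp)
  finally show ?thesis by simp
qed

lemma weight_tail_derivative: "(weight_tail has_real_derivative - (1 / japanese y powr (1 + \<alpha>))) (at y)"
proof -
  let ?w = "\<lambda>s. 1 / japanese s powr (1 + \<alpha>)"
  have "((\<lambda>t. integral {y - 1..t} ?w) has_real_derivative ?w y) (at y within {y - 1..y + 1})"
    by (rule integral_has_real_derivative) (auto intro: weight_continuous)
  then have "((\<lambda>t. integral {y - 1..t} ?w) has_real_derivative ?w y) (at y)"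
    by (subst (asm) at_within_Icc_at) auto
  then have "((\<lambda>t. weight_tail (y - 1) - integral {y - 1..t} ?w) has_real_derivative 0 - ?w y) (at y)"
    by (intro derivative_intros)
  moreover have "eventually (\<lambda>t. t \<in> {y - 1<..}) (nhds y)"
    by (intro eventually_nhds_in_open) auto
  then have "eventually (\<lambda>t. weight_tail (y - 1) - integral {y - 1..t} ?w = weight_tail t) (nhds y)"
  proof eventually_elim
    case (elim t)
    show ?case using weight_tail_diff[of "y - 1" t] elim by simp
  qed
  ultimately show ?thesis by (subst (asm) DERIV_cong_ev[OF refl _ refl]) auto
qed

text \<open>
  The tail at \<open>y\<close> contains the interval from \<open>\<langle>y\<rangle>\<close> to \<open>2 \<langle>y\<rangle>\<close>, on which
  \<open>\<langle>s\<rangle> \<le> 3 \<langle>y\<rangle>\<close>.  Working with \<open>\<langle>y\<rangle>\<close> in place of \<open>y\<close> avoids a case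
  distinction on the sign of \<open>y\<close>.
\<close>

lemma weight_tail_lower_bound: "japanese y powr (- \<alpha>) / 3 powr (1 + \<alpha>) \<le> weight_tail y"
proof -
  let ?w = "\<lambda>s. 1 / japanese s powr (1 + \<alpha>)"
  define J where "J = japanese y"
  have J: "J \<ge> 1" "y \<le> J" using japanese_ge_1[of y] abs_le_japanese[of y] by (auto simp: J_def)
  have "J powr (- \<alpha>) / 3 powr (1 + \<alpha>) = J * (1 / (3 * J) powr (1 + \<alpha>))"
  proof -
    have "(3 * J) powr (1 + \<alpha>) = 3 powr (1 + \<alpha>) * (J * J powr \<alpha>)"
      using J by (simp add: powr_mult powr_add)
    then show ?thesis using J by (simp add: powr_minus divide_simps)
  qed
  also have "\<dots> = integral {J..2 * J} (\<lambda>s. 1 / (3 * J) powr (1 + \<alpha>))"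
    using J by simp
  also have "\<dots> \<le> integral {J..2 * J} ?w"
  proof (rule integral_le)
    fix s assume s: "s \<in> {J..2 * J}"
    have "s\<^sup>2 \<le> (2 * J)\<^sup>2" using s J by (intro power_mono) auto
    moreover have "1 \<le> J\<^sup>2" using J by (simp add: one_le_power)
    ultimately have "(japanese s)\<^sup>2 \<le> (3 * J)\<^sup>2" by (simp add: japanese_power2 power_mult_distrib)
    then have "japanese s \<le> 3 * J" by (rule power2_le_imp_le) (use J in auto)
    then have "japanese s powr (1 + \<alpha>) \<le> (3 * J) powr (1 + \<alpha>)" using alpha by (intro powr_mono2) auto
    then show "1 / (3 * J) powr (1 + \<alpha>) \<le> ?w s"
      by (intro divide_left_mono mult_pos_pos) (use J in \<open>auto simp:\<close>)
  qed (auto intro!: integrable_continuous_real weight_continuous)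
  also have "\<dots> = weight_tail J - weight_tail (2 * J) " using J by (subst weight_tail_diff) auto
  finally have "J powr (- \<alpha>) / 3 powr (1 + \<alpha>) \<le> weight_tail J - weight_tail (2 * J)" .
  moreover have "weight_tail (2 * J) \<ge> 0" unfolding weight_tail_def set_lebesgue_integral_def by simp
  moreover have "weight_tail y - weight_tail J \<ge> 0" using J by (subst weight_tail_diff) (auto intro!: integral_nonneg integrable_continuous_real weight_continuous)
  ultimately show ?thesis unfolding J_def by linarith
qed

lemma weight_tail_pos: "0 < weight_tail y"
  by (rule less_le_trans[OF _ weight_tail_lower_bound]) simp

lemma weight_tail_minus: "weight_tail (- y) + weight_tail y = weight_mass"
proof -
  let ?w = "\<lambda>s. 1 / japanese s powr (1 + \<alpha>)"
  have "weight_tail (- y) = (LINT s|lborel. indicator {- y..} (0 + (- 1) * s) *\<^sub>R ?w (0 + (- 1) * s))"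
    unfolding weight_tail_def set_lebesgue_integral_def
    using lborel_integral_real_affine[of "-1" "\<lambda>s. indicator {- y..} s *\<^sub>R ?w s" 0] by simp
  also have "\<dots> = (LINT s:{..y}|lborel. ?w s)"
    unfolding set_lebesgue_integral_def
    by (rule Bochner_Integration.integral_cong) (auto simp: indicator_def)
  also have "\<dots> = (LINT s:{..<y}|lborel. ?w s)"
    unfolding set_lebesgue_integral_def
    by (rule integral_cong_AE)
       (use AE_lborel_singleton[of y] in \<open>auto simp: indicator_def elim!: eventually_mono\<close>)
  finally have 1: "weight_tail (- y) = (LINT s:{..<y}|lborel. ?w s)" .
  have "weight_mass = (LINT s:({..<y} \<union> {y..})|lborel. ?w s)"
    unfolding weight_mass_def set_lebesgue_integral_def
    by (rule Bochner_Integration.integral_cong) (auto simp: indicator_def)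
  also have "\<dots> = (LINT s:{..<y}|lborel. ?w s) + (LINT s:{y..}|lborel. ?w s)"
    by (rule set_integral_Un; auto intro!: weight_set_integrable)
  finally show ?thesis using 1 by (simp add: weight_tail_def)
qed

lemma weight_mass_pos: "0 < weight_mass"
  using weight_tail_minus[of 0] weight_tail_pos[of 0] by simp

lemma phi_pos: "0 < phi \<alpha> y"
  unfolding phi_eq using weight_tail_pos weight_mass_pos by simp

text \<open>
  Thanks to this symmetry \<open>sqrt (1 - \<phi>)\<close> needs no analysis of its own.
\<close>

lemma phi_minus: "1 - phi \<alpha> y = phi \<alpha> (- y)"
  unfolding phi_eq using weight_mass_pos weight_tail_minus[of y] by (simp add: field_simps)

lemma phi_lower_bound:
  obtains \<kappa> where "\<kappa> > 0" "\<And>y. \<kappa> * japanese y powr (- \<alpha>) \<le> phi \<alpha> y"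
proof
  show "0 < inverse (3 powr (1 + \<alpha>) * weight_mass)" using weight_mass_pos by simp
  show "inverse (3 powr (1 + \<alpha>) * weight_mass) * japanese y powr (- \<alpha>) \<le> phi \<alpha> y" for y
    unfolding phi_eq using divide_right_mono[OF weight_tail_lower_bound[of y], of weight_mass] weight_mass_pos
    by (simp add: divide_inverse mult_ac)
qed

lemma phi_derivative:
  "(phi \<alpha> has_real_derivative - (inverse weight_mass * japanese y powr (- (1 + \<alpha>)))) (at y)"
  unfolding phi_eq[abs_def]
  by (rule DERIV_cong[OF DERIV_cdivide[OF weight_tail_derivative]]) (simp only: powr_minus divide_inverse, simp)

lemma inverse_sqrt_phi_bound:
  obtains B where "B > 0" "\<And>y. inverse (sqrt (phi \<alpha> y)) \<le> B * japanese y powr (\<alpha> / 2)"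
proof -
  obtain \<kappa> where k: "\<kappa> > 0" "\<And>y. \<kappa> * japanese y powr (- \<alpha>) \<le> phi \<alpha> y" using phi_lower_bound by blast
  have "inverse (sqrt (phi \<alpha> y)) \<le> inverse (sqrt \<kappa>) * japanese y powr (\<alpha> / 2)" for y
  proof -
    have "sqrt (japanese y powr (- \<alpha>)) = japanese y powr (- (\<alpha> / 2))"
      by (simp add: powr_half_sqrt_powr[symmetric])
    then have "sqrt \<kappa> * japanese y powr (- (\<alpha> / 2)) \<le> sqrt (phi \<alpha> y)"
      using real_sqrt_le_mono[OF k(2)[of y]] by (simp add: real_sqrt_mult)
    moreover have "0 < sqrt \<kappa> * japanese y powr (- (\<alpha> / 2))" using k(1) by simp
    ultimately have "inverse (sqrt (phi \<alpha> y)) \<le> inverse (sqrt \<kappa> * japanese y powr (- (\<alpha> / 2)))"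
      by (rule le_imp_inverse_le)
    then show ?thesis by (simp add: powr_minus)
  qed
  with k(1) that[of "inverse (sqrt \<kappa>)"] show ?thesis by simp
qed

end

text \<open>
  Up to powers of \<open>y\<close> and \<open>\<langle>y\<rangle>\<close>, the derivative of \<open>sqrt \<circ> \<phi>\<close> is
  \<open>1 / sqrt \<phi>\<close>, so all its derivatives are combinations of the monomials below.  Since
  \<open>1 / sqrt \<phi> = O(\<langle>y\<rangle> powr (\<alpha> / 2))\<close>, a monomial is \<open>O(\<langle>y\<rangle> powr (- e))\<close> for the
  number \<open>e\<close> attached to it.
\<close>

inductive phi_symbol :: "real \<Rightarrow> real \<Rightarrow> (real \<Rightarrow> real) \<Rightarrow> bool" for \<alpha> where
  monomial: "e = b - real j - real k * (\<alpha> / 2) \<Longrightarrow>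
    phi_symbol \<alpha> e (\<lambda>y. C * (y ^ j * japanese y powr (- b) * inverse (sqrt (phi \<alpha> y)) ^ k))"
| add: "phi_symbol \<alpha> e f \<Longrightarrow> phi_symbol \<alpha> e g \<Longrightarrow> phi_symbol \<alpha> e (\<lambda>y. f y + g y)"

lemma phi_symbol_bound:
  assumes alpha: "0 < \<alpha>"
  shows "phi_symbol \<alpha> e f \<Longrightarrow> \<exists>C\<ge>0. \<forall>y. \<bar>f y\<bar> \<le> C * japanese y powr (- e)"
proof (induction rule: phi_symbol.induct)
  case (monomial e b j k C)
  obtain B where B: "B > 0" "\<And>y. inverse (sqrt (phi \<alpha> y)) \<le> B * japanese y powr (\<alpha> / 2)"
    using inverse_sqrt_phi_bound[OF alpha] by blast
  have "\<bar>C * (y ^ j * japanese y powr (- b) * inverse (sqrt (phi \<alpha> y)) ^ k)\<bar> \<le> (\<bar>C\<bar> * B ^ k) * japanese y powr (- e)" for y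
  proof -
    have p: "0 < inverse (sqrt (phi \<alpha> y))" using phi_pos[OF alpha] by simp
    have "\<bar>y\<bar> ^ j \<le> japanese y powr real j"
      using power_mono[OF abs_le_japanese[of y], of j] by (simp add: powr_realpow)
    moreover have "inverse (sqrt (phi \<alpha> y)) ^ k \<le> B ^ k * japanese y powr (real k * (\<alpha> / 2))"
    proof -
      have "(japanese y powr (\<alpha> / 2)) ^ k = japanese y powr (real k * (\<alpha> / 2))"
        by (simp add: powr_power mult.commute)
      then show ?thesis
        using power_mono[OF B(2)[of y], of k] p by (simp add: power_mult_distrib)
    qed
    ultimately have "\<bar>y\<bar> ^ j * japanese y powr (- b) * inverse (sqrt (phi \<alpha> y)) ^ k
       \<le> japanese y powr real j * japanese y powr (- b) * (B ^ k * japanese y powr (real k * (\<alpha> / 2)))"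
      using p by (intro mult_mono) auto
    also have "\<dots> = B ^ k * (japanese y powr real j * japanese y powr (- b) * japanese y powr (real k * (\<alpha> / 2)))" by simp
    also have "\<dots> = B ^ k * japanese y powr (- e)"
      unfolding powr_add[symmetric] monomial by (simp add: algebra_simps)
    finally have "\<bar>C\<bar> * (\<bar>y\<bar> ^ j * japanese y powr (- b) * inverse (sqrt (phi \<alpha> y)) ^ k) \<le> \<bar>C\<bar> * (B ^ k * japanese y powr (- e))"
      by (rule mult_left_mono) simp
    moreover have "\<bar>C * (y ^ j * japanese y powr (- b) * inverse (sqrt (phi \<alpha> y)) ^ k)\<bar>
      = \<bar>C\<bar> * (\<bar>y\<bar> ^ j * japanese y powr (- b) * inverse (sqrt (phi \<alpha> y)) ^ k)"
      using p by (simp add: abs_mult power_abs)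
    ultimately show ?thesis by (simp add: mult.assoc)
  qed
  with B(1) show ?case by (intro exI[of _ "\<bar>C\<bar> * B ^ k"]) auto
next
  case (add e f g)
  then obtain C D where C: "C \<ge> 0" "\<And>y. \<bar>f y\<bar> \<le> C * japanese y powr (- e)"
    and D: "D \<ge> 0" "\<And>y. \<bar>g y\<bar> \<le> D * japanese y powr (- e)" by blast
  have "\<bar>f y + g y\<bar> \<le> (C + D) * japanese y powr (- e)" for y
    using abs_triangle_ineq[of "f y" "g y"] C(2)[of y] D(2)[of y] by (simp add: distrib_right)
  with C D show ?case by (intro exI[of _ "C + D"]) auto
qed

lemma has_real_derivative_japanese_powr:
  "((\<lambda>y. japanese y powr (- b)) has_real_derivative - b * (y * japanese y powr (- (b + 2)))) (at y)"
proof -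
  have "((\<lambda>y. japanese y powr (- b)) has_real_derivative - b * japanese y powr (- b - 1) * (y / japanese y)) (at y)"
  proof (rule DERIV_chain2[OF _ has_real_derivative_japanese])
    show "((\<lambda>z. z powr (- b)) has_real_derivative - b * japanese y powr (- b - 1)) (at (japanese y))"
      by (rule has_real_derivative_powr) simp
  qed
  moreover have "japanese y powr (- b - 1) * (y / japanese y) = y * japanese y powr (- (b + 2))"
  proof -
    have "- b - 1 = - (b + 2) + 1" by simp
    then have "japanese y powr (- b - 1) = japanese y powr (- (b + 2)) * japanese y powr 1"
      by (simp only: powr_add)
    then show ?thesis by simp
  qed
  ultimately show ?thesis by (simp only: mult.assoc)
qed

lemma has_real_derivative_sqrt_phi:
  assumes "0 < \<alpha>"
  shows "((\<lambda>y. sqrt (phi \<alpha> y)) has_real_derivative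
    - (inverse (weight_mass \<alpha>) / 2) * (y ^ 0 * japanese y powr (- (1 + \<alpha>)) * inverse (sqrt (phi \<alpha> y)) ^ 1)) (at y)"
  using DERIV_chain2[OF DERIV_real_sqrt[OF phi_pos[OF assms]] phi_derivative[OF assms], of y]
  by (simp add: field_simps)

lemma has_real_derivative_inverse_sqrt_phi_power:
  assumes "0 < \<alpha>"
  shows "((\<lambda>y. inverse (sqrt (phi \<alpha> y)) ^ k) has_real_derivative
    real k * (inverse (weight_mass \<alpha>) / 2) * (japanese y powr (- (1 + \<alpha>)) * inverse (sqrt (phi \<alpha> y)) ^ (k + 2))) (at y)"
proof -
  have nz: "sqrt (phi \<alpha> y) \<noteq> 0" using phi_pos[OF assms, of y] by simp
  have "inverse (sqrt (phi \<alpha> y)) ^ (k - Suc 0) * (inverse (sqrt (phi \<alpha> y)) ^ 3) = inverse (sqrt (phi \<alpha> y)) ^ (k + 2)" if "k > 0"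
    unfolding power_add[symmetric] using that by simp
  then show ?thesis
    by (intro DERIV_cong[OF DERIV_power[OF DERIV_inverse'[OF has_real_derivative_sqrt_phi[OF assms] nz]]])
       (cases k; simp add: power3_eq_cube power2_eq_square mult_ac)
qed

text \<open>
  Each of the three factors of a monomial contributes a monomial of order \<open>e + 1\<close>; for the third factor this is
  because \<open>(1 / sqrt \<phi>)' = c \<langle>y\<rangle> powr (- (1 + \<alpha>)) (1 / sqrt \<phi>)\<^sup>3\<close> and
  \<open>(1 + \<alpha>) - 2 (\<alpha> / 2) = 1\<close>.
\<close>

lemma phi_symbol_derivative:
  assumes alpha: "0 < \<alpha>"
  shows "phi_symbol \<alpha> e f \<Longrightarrow> \<exists>f'. phi_symbol \<alpha> (e + 1) f' \<and> (\<forall>y. (f has_real_derivative f' y) (at y))"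
proof (induction rule: phi_symbol.induct)
  case (monomial e b j k C)
  define ig where "ig y = inverse (sqrt (phi \<alpha> y))" for y
  define c where "c = inverse (weight_mass \<alpha>) / 2"
  \<comment> \<open>For \<open>j = 0\<close> the truncated \<open>j - 1\<close> does not lower the degree, so the exponent of
    \<open>\<langle>y\<rangle>\<close> is adjusted to give the vanishing term the order \<open>e + 1\<close>.\<close>
  define t1 where "t1 = (\<lambda>y. C * real j * (y ^ (j - 1) * japanese y powr (- (if j = 0 then b + 1 else b)) * ig y ^ k))"
  define t2 where "t2 = (\<lambda>y. C * (- b) * (y ^ (j + 1) * japanese y powr (- (b + 2)) * ig y ^ k))"
  define t3 where "t3 = (\<lambda>y. C * (real k * c) * (y ^ j * japanese y powr (- (b + (1 + \<alpha>))) * ig y ^ (k + 2)))"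
  have "phi_symbol \<alpha> (e + 1) t1" unfolding t1_def ig_def
    by (rule phi_symbol.monomial) (auto simp: monomial)
  moreover have "phi_symbol \<alpha> (e + 1) t2" unfolding t2_def ig_def
    by (rule phi_symbol.monomial) (auto simp: monomial)
  moreover have "phi_symbol \<alpha> (e + 1) t3" unfolding t3_def ig_def
    by (rule phi_symbol.monomial) (auto simp: monomial field_simps)
  ultimately have "phi_symbol \<alpha> (e + 1) (\<lambda>y. t1 y + t2 y + t3 y)" by (intro phi_symbol.add)
  moreover have "((\<lambda>y. C * (y ^ j * japanese y powr (- b) * ig y ^ k)) has_real_derivative t1 y + t2 y + t3 y) (at y)" for y
  proof -
    have d1: "((\<lambda>y. y ^ j) has_real_derivative real j * y ^ (j - 1)) (at y)"
      using DERIV_pow[of j y] by simp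
    have d3: "((\<lambda>y. ig y ^ k) has_real_derivative real k * c * (japanese y powr (- (1 + \<alpha>)) * ig y ^ (k + 2))) (at y)"
      unfolding ig_def c_def by (rule has_real_derivative_inverse_sqrt_phi_power[OF alpha])
    have J: "japanese y powr (- (b + (1 + \<alpha>))) = japanese y powr (- b) * japanese y powr (- (1 + \<alpha>))"
      unfolding powr_add[symmetric] by simp
    have t1': "t1 y = C * real j * (y ^ (j - 1) * japanese y powr (- b) * ig y ^ k)" by (simp add: t1_def)
    show ?thesis
      by (rule DERIV_cong[OF DERIV_cmult[OF DERIV_mult[OF DERIV_mult[OF d1 has_real_derivative_japanese_powr] d3]]])
         (simp only: t1' t2_def t3_def J, simp add: algebra_simps)
  qed
  ultimately show ?case unfolding ig_def by blast
next
  case (add e f g)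
  then obtain f' g' where "phi_symbol \<alpha> (e + 1) f'" "\<forall>y. (f has_real_derivative f' y) (at y)"
    "phi_symbol \<alpha> (e + 1) g'" "\<forall>y. (g has_real_derivative g' y) (at y)" by blast
  then show ?case by (intro exI[of _ "\<lambda>y. f' y + g' y"]) (auto intro: phi_symbol.add DERIV_add)
qed

lemma decaying_class_phi_symbol:
  assumes alpha: "0 < \<alpha>"
  shows "decaying_class e0 (\<lambda>h. \<exists>F e. e0 \<le> e \<and> phi_symbol \<alpha> e F \<and> h = (\<lambda>x. complex_of_real (F x)))"
  unfolding decaying_class_def
proof (intro allI impI, elim exE conjE, intro conjI)
  fix h F e assume F: "e0 \<le> e" "phi_symbol \<alpha> e F" "h = (\<lambda>x. complex_of_real (F x))"
  obtain F' where F': "phi_symbol \<alpha> (e + 1) F'" "\<And>y. (F has_real_derivative F' y) (at y)"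
    using phi_symbol_derivative[OF alpha F(2)] by blast
  have "(h has_vector_derivative complex_of_real (F' x)) (at x)" for x
    unfolding F using F'(2) by (auto intro!: has_vector_derivative_of_real simp: has_real_derivative_iff_has_vector_derivative)
  with F(1) F'(1) show "\<exists>f'. (\<exists>F e. e0 \<le> e \<and> phi_symbol \<alpha> e F \<and> f' = (\<lambda>x. complex_of_real (F x))) \<and> (\<forall>x. (h has_vector_derivative f' x) (at x))"
    by (intro exI[of _ "\<lambda>x. complex_of_real (F' x)"] conjI exI[of _ F'] exI[of _ "e + 1"]) auto
  obtain C where C: "C \<ge> 0" "\<And>y. \<bar>F y\<bar> \<le> C * japanese y powr (- e)" using phi_symbol_bound[OF alpha F(2)] by blast
  have "norm (h x) \<le> C * japanese x powr (- e0)" for x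
  proof -
    have "norm (h x) \<le> C * japanese x powr (- e)" using C F by simp
    also have "\<dots> \<le> C * japanese x powr (- e0)"
      using C(1) F(1) japanese_ge_1 by (intro mult_left_mono powr_mono) auto
    finally show ?thesis .
  qed
  then show "\<exists>C. \<forall>x. norm (h x) \<le> C * japanese x powr (- e0)" by blast
qed

text \<open>
  The derivative of \<open>sqrt \<circ> \<phi>\<close> is a symbol of order \<open>1 + \<alpha> / 2 > 1\<close>, so its Fourier transform
  \<open>G\<close> is bounded with rapid decay.  The first moment condition on \<open>H\<close> allows for the singularity
  \<open>|\<zeta>| powr (\<alpha> - 1)\<close> at the origin when \<open>\<alpha> < 1\<close>; together with the
  case \<open>n = 0\<close> of the second one it yields the constant of the estimate.  In the second one the factor
  \<open>|\<zeta>|\<close> cancels the pole of \<open>H\<close>; the higher powers justify the interchanges of integrals.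
\<close>

theorem sqrt_phi_representation:
  assumes alpha: "0 < \<alpha>"
  obtains H where "H \<in> borel_measurable borel"
    "integrable lborel (\<lambda>\<zeta>. \<bar>\<zeta>\<bar> powr \<alpha> * norm (H \<zeta>))"
    "\<And>n. integrable lborel (\<lambda>\<zeta>. \<bar>\<zeta>\<bar> * (1 + \<bar>\<zeta>\<bar>) ^ n * norm (H \<zeta>))"
    "\<And>x. complex_of_real (sqrt (phi \<alpha> x))
       = complex_of_real (sqrt (phi \<alpha> 0)) + (LINT \<zeta>|lborel. (cis (x * \<zeta>) - 1) * H \<zeta>)"
proof -
  define q' where "q' y = - (inverse (weight_mass \<alpha>) / 2) * (y ^ 0 * japanese y powr (- (1 + \<alpha>)) * inverse (sqrt (phi \<alpha> y)) ^ 1)" for y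
  define P where "P h \<longleftrightarrow> (\<exists>F e. 1 + \<alpha> / 2 \<le> e \<and> phi_symbol \<alpha> e F \<and> h = (\<lambda>x. complex_of_real (F x)))" for h
  have cls: "decaying_class (1 + \<alpha> / 2) P" unfolding P_def[abs_def] by (rule decaying_class_phi_symbol[OF alpha])
  have e1: "1 + \<alpha> / 2 > 1" using alpha by simp
  define f where "f = (\<lambda>x. complex_of_real (q' x))"
  have "phi_symbol \<alpha> (1 + \<alpha> / 2) q'" unfolding q'_def[abs_def] by (rule phi_symbol.monomial) simp
  then have f: "P f" unfolding P_def f_def by blast
  note fint = decaying_integrable[OF cls e1 f]
  define G where "G = fourier f"
  have Gm [measurable]: "G \<in> borel_measurable borel" unfolding G_def by (rule measurable_fourier[OF fint])
  have Gdecay: "\<exists>C\<ge>0. \<forall>\<zeta>. (1 + \<bar>\<zeta>\<bar>) ^ n * norm (G \<zeta>) \<le> C" for n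
    unfolding G_def by (rule fourier_decay[OF cls e1 f])
  have Gdecay': "\<exists>C\<ge>0. \<forall>\<zeta>. (1 + \<bar>\<zeta>\<bar>) ^ n * norm (G \<zeta>) \<le> C * japanese \<zeta> powr (- real m)" for n m
  proof -
    obtain C where C: "C \<ge> 0" "\<And>\<zeta>. (1 + \<bar>\<zeta>\<bar>) ^ (n + m) * norm (G \<zeta>) \<le> C" using Gdecay by blast
    have "(1 + \<bar>\<zeta>\<bar>) ^ n * norm (G \<zeta>) \<le> C * japanese \<zeta> powr (- real m)" for \<zeta>
    proof -
      have "japanese \<zeta> ^ m * ((1 + \<bar>\<zeta>\<bar>) ^ n * norm (G \<zeta>)) \<le> (1 + \<bar>\<zeta>\<bar>) ^ m * ((1 + \<bar>\<zeta>\<bar>) ^ n * norm (G \<zeta>))"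
        by (intro mult_right_mono power_mono japanese_le_1_plus_abs) auto
      also have "\<dots> = (1 + \<bar>\<zeta>\<bar>) ^ (n + m) * norm (G \<zeta>)" by (simp add: power_add)
      also have "\<dots> \<le> C" by (rule C)
      finally have "(1 + \<bar>\<zeta>\<bar>) ^ n * norm (G \<zeta>) \<le> C / japanese \<zeta> ^ m"
        by (simp add: pos_le_divide_eq mult.commute)
      then show ?thesis by (simp add: powr_minus powr_realpow divide_inverse)
    qed
    with C(1) show ?thesis by blast
  qed
  have Gint: "integrable lborel (\<lambda>\<zeta>. (1 + \<bar>\<zeta>\<bar>) ^ n * norm (G \<zeta>))" for n
  proof -
    obtain C where C: "C \<ge> 0" "\<And>\<zeta>. (1 + \<bar>\<zeta>\<bar>) ^ n * norm (G \<zeta>) \<le> C * japanese \<zeta> powr (- real 2)" using Gdecay' by blast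
    show ?thesis
      by (rule Bochner_Integration.integrable_bound[OF integrable_mult_right[OF integrable_japanese_powr[of "real 2"], of C]])
         (use C in auto)
  qed
  obtain B where B: "\<And>x. norm (f x) \<le> B"
  proof -
    obtain C where C: "C \<ge> 0" "\<And>x. norm (f x) \<le> C * japanese x powr (- (1 + \<alpha> / 2))"
      using decaying_bound[OF cls e1 f] by blast
    have "C * japanese x powr (- (1 + \<alpha> / 2)) \<le> C * japanese x powr 0" for x
      using C(1) alpha japanese_ge_1 by (intro mult_left_mono powr_mono) auto
    also have "C * japanese x powr 0 = C" for x by simp
    finally show ?thesis using C(2) that[of C] order_trans by blast
  qed
  have inv: "inverse_fourier G x = complex_of_real (q' x)" for x
  proof -
    have "integrable lborel G" by (rule integrable_norm_cancel) (use Gint[of 0] in auto)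
    then show ?thesis
      using fourier_inversion[OF fint _ decaying_continuous[OF cls e1 f] B] by (simp add: f_def G_def)
  qed
  define H where "H = (\<lambda>\<zeta>. G \<zeta> / (2 * pi * \<i> * \<zeta>))"
  have nH: "norm (H \<zeta>) * \<bar>\<zeta>\<bar> \<le> norm (G \<zeta>)" for \<zeta>
    unfolding H_def by (rule norm_divide_frequency_le)
  show ?thesis
  proof
    show [measurable]: "H \<in> borel_measurable borel" unfolding H_def by measurable
    show "complex_of_real (sqrt (phi \<alpha> x)) = complex_of_real (sqrt (phi \<alpha> 0)) + (LINT \<zeta>|lborel. (cis (x * \<zeta>) - 1) * H \<zeta>)" for x
      unfolding H_def
      by (rule antiderivative_fourier_representation[OF has_real_derivative_sqrt_phi[OF alpha, folded q'_def] inv])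
         (use Gint[of 1] in auto)
    show "integrable lborel (\<lambda>\<zeta>. \<bar>\<zeta>\<bar> * (1 + \<bar>\<zeta>\<bar>) ^ n * norm (H \<zeta>))" for n
    proof (rule Bochner_Integration.integrable_bound[OF Gint[of n]])
      show "AE \<zeta> in lborel. norm (\<bar>\<zeta>\<bar> * (1 + \<bar>\<zeta>\<bar>) ^ n * norm (H \<zeta>)) \<le> norm ((1 + \<bar>\<zeta>\<bar>) ^ n * norm (G \<zeta>))"
        using mult_left_mono[OF nH, of "(1 + \<bar>\<zeta>\<bar>) ^ n" for \<zeta>] by (auto simp: mult_ac)
    qed measurable
    obtain m :: nat where m: "\<alpha> < real m" using reals_Archimedean2 by blast
    obtain C where C: "C \<ge> 0" "\<And>\<zeta>. norm (G \<zeta>) \<le> C * japanese \<zeta> powr (- real m)"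
      using Gdecay'[of 0 m] by auto
    show "integrable lborel (\<lambda>\<zeta>. \<bar>\<zeta>\<bar> powr \<alpha> * norm (H \<zeta>))"
    proof (rule Bochner_Integration.integrable_bound[OF integrable_mult_right[OF integrable_powr_japanese[of "\<alpha> - 1" "real m"], of C]])
      show "AE \<zeta> in lborel. norm (\<bar>\<zeta>\<bar> powr \<alpha> * norm (H \<zeta>)) \<le> norm (C * (\<bar>\<zeta>\<bar> powr (\<alpha> - 1) * japanese \<zeta> powr (- real m)))"
      proof (rule AE_I2)
        fix \<zeta> :: real
        have "\<bar>\<zeta>\<bar> powr \<alpha> * norm (H \<zeta>) = \<bar>\<zeta>\<bar> powr (\<alpha> - 1) * (norm (H \<zeta>) * \<bar>\<zeta>\<bar>)"
          by (cases "\<zeta> = 0") (auto simp: powr_diff)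
        also have "\<dots> \<le> \<bar>\<zeta>\<bar> powr (\<alpha> - 1) * (C * japanese \<zeta> powr (- real m))"
          by (intro mult_left_mono order_trans[OF nH C(2)]) simp
        finally show "norm (\<bar>\<zeta>\<bar> powr \<alpha> * norm (H \<zeta>)) \<le> norm (C * (\<bar>\<zeta>\<bar> powr (\<alpha> - 1) * japanese \<zeta> powr (- real m)))"
          using C(1) by (simp add: mult_ac)
      qed
    qed (use alpha m in auto)
  qed
qed

section \<open>Square norms and an inequality of Young\<close>

lemma L2_norm_le:
  assumes c: "c \<ge> 0"
    and le: "(\<integral>\<^sup>+x. ennreal ((norm (f x))\<^sup>2) \<partial>lborel) \<le> ennreal (c\<^sup>2) * (\<integral>\<^sup>+x. ennreal ((norm (g x))\<^sup>2) \<partial>lborel)"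
  shows "L2_norm f \<le> ennreal c * L2_norm g"
proof -
  define I where "I = (\<integral>\<^sup>+x. ennreal ((norm (f x))\<^sup>2) \<partial>lborel)"
  define J where "J = (\<integral>\<^sup>+x. ennreal ((norm (g x))\<^sup>2) \<partial>lborel)"
  have IJ: "I \<le> ennreal (c\<^sup>2) * J" using le by (simp add: I_def J_def)
  show ?thesis
  proof (cases J)
    case (real r)
    with IJ c have "I \<le> ennreal (c\<^sup>2 * r)" by (simp add: ennreal_mult)
    then obtain i where i: "I = ennreal i" "0 \<le> i" "i \<le> c\<^sup>2 * r"
      using real by (cases I) (auto simp: top_unique)
    have "sqrt i \<le> c * sqrt r"
      using real_sqrt_le_mono[OF i(3)] c by (simp add: real_sqrt_mult)
    then have "ennreal (sqrt i) \<le> ennreal c * ennreal (sqrt r)"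
      using c real by (simp add: ennreal_mult[symmetric] ennreal_leI)
    then show ?thesis using i real by (simp add: L2_norm_def I_def[symmetric] J_def[symmetric] Let_def)
  next
    case top
    show ?thesis
    proof (cases "c = 0")
      case True
      then have "I = 0" using IJ by simp
      then show ?thesis using True by (simp add: L2_norm_def I_def[symmetric] Let_def)
    next
      case False
      then have "ennreal c * L2_norm g = \<top>" using top c
        by (simp add: L2_norm_def J_def[symmetric] Let_def ennreal_mult_top)
      then show ?thesis by simp
    qed
  qed
qed

text \<open>
  Young's inequality for \<open>L\<^sup>1 * L\<^sup>2\<close>, by the Cauchy-Schwarz inequality with respect to the weight
  \<open>W\<close> and Tonelli.
\<close>

lemma young_L2:
  fixes F :: "real \<Rightarrow> real \<Rightarrow> complex"
  assumes [measurable]: "case_prod F \<in> borel_measurable (lborel \<Otimes>\<^sub>M lborel)"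
    and W: "integrable lborel W" "\<And>z. 0 \<le> W z"
    and [measurable]: "V \<in> borel_measurable borel" and V: "\<And>x. 0 \<le> V x"
    and bound: "\<And>x z. norm (F x z) \<le> W z * V (x - a * z)"
  shows "(\<integral>\<^sup>+x. ennreal ((norm (LINT z|lborel. F x z))\<^sup>2) \<partial>lborel)
       \<le> ennreal ((LINT z|lborel. W z)\<^sup>2) * (\<integral>\<^sup>+x. ennreal ((V x)\<^sup>2) \<partial>lborel)"
proof -
  have [measurable]: "W \<in> borel_measurable borel" using borel_measurable_integrable[OF W(1)] by simp
  have IW: "(\<integral>\<^sup>+z. ennreal (W z) \<partial>lborel) = ennreal (LINT z|lborel. W z)"
    by (rule nn_integral_eq_integral) (use W in auto)
  have shift: "(\<integral>\<^sup>+x. ennreal ((V (x - a * z))\<^sup>2) \<partial>lborel) = (\<integral>\<^sup>+x. ennreal ((V x)\<^sup>2) \<partial>lborel)" for z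
    using nn_integral_real_affine[of "\<lambda>x. ennreal ((V x)\<^sup>2)" 1 "- (a * z)"] by simp
  have pw: "ennreal ((norm (LINT z|lborel. F x z))\<^sup>2)
      \<le> ennreal (LINT z|lborel. W z) * (\<integral>\<^sup>+z. ennreal (W z) * ennreal ((V (x - a * z))\<^sup>2) \<partial>lborel)" for x
  proof -
    have "ennreal (norm (LINT z|lborel. F x z)) \<le> (\<integral>\<^sup>+z. ennreal (norm (F x z)) \<partial>lborel)"
      by (cases "integrable lborel (F x)") (auto intro: integral_norm_bound_ennreal simp: not_integrable_integral_eq)
    also have "\<dots> \<le> (\<integral>\<^sup>+z. ennreal (sqrt (W z)) * ennreal (sqrt (W z) * V (x - a * z)) \<partial>lborel)"
    proof (intro nn_integral_mono)
      fix z
      have "W z * V (x - a * z) = sqrt (W z) * (sqrt (W z) * V (x - a * z))"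
        using W(2)[of z] by (simp add: mult.assoc[symmetric])
      then have "norm (F x z) \<le> sqrt (W z) * (sqrt (W z) * V (x - a * z))"
        using bound[of x z] by (simp only:)
      from ennreal_leI[OF this]
      show "ennreal (norm (F x z)) \<le> ennreal (sqrt (W z)) * ennreal (sqrt (W z) * V (x - a * z))"
        using W(2)[of z] V[of "x - a * z"] by (subst (asm) ennreal_mult) auto
    qed
    finally have "(ennreal (norm (LINT z|lborel. F x z)))\<^sup>2
       \<le> (\<integral>\<^sup>+z. ennreal (sqrt (W z)) * ennreal (sqrt (W z) * V (x - a * z)) \<partial>lborel)\<^sup>2"
      by (rule power_mono) simp
    also have "\<dots> \<le> (\<integral>\<^sup>+z. (ennreal (sqrt (W z)))\<^sup>2 \<partial>lborel) * (\<integral>\<^sup>+z. (ennreal (sqrt (W z) * V (x - a * z)))\<^sup>2 \<partial>lborel)"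
      by (rule Cauchy_Schwarz_nn_integral) auto
    also have "(\<integral>\<^sup>+z. (ennreal (sqrt (W z)))\<^sup>2 \<partial>lborel) = (\<integral>\<^sup>+z. ennreal (W z) \<partial>lborel)"
      by (intro nn_integral_cong) (simp add: ennreal_power W(2))
    also have "(\<integral>\<^sup>+z. (ennreal (sqrt (W z) * V (x - a * z)))\<^sup>2 \<partial>lborel) = (\<integral>\<^sup>+z. ennreal (W z) * ennreal ((V (x - a * z))\<^sup>2) \<partial>lborel)"
      by (intro nn_integral_cong) (simp add: ennreal_power W(2) V power_mult_distrib ennreal_mult[symmetric])
    finally show ?thesis by (simp add: ennreal_power IW)
  qed
  have "(\<integral>\<^sup>+x. ennreal ((norm (LINT z|lborel. F x z))\<^sup>2) \<partial>lborel)
     \<le> (\<integral>\<^sup>+x. ennreal (LINT z|lborel. W z) * (\<integral>\<^sup>+z. ennreal (W z) * ennreal ((V (x - a * z))\<^sup>2) \<partial>lborel) \<partial>lborel)"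
    by (rule nn_integral_mono) (rule pw)
  also have "\<dots> = ennreal (LINT z|lborel. W z) * (\<integral>\<^sup>+x. (\<integral>\<^sup>+z. ennreal (W z) * ennreal ((V (x - a * z))\<^sup>2) \<partial>lborel) \<partial>lborel)"
    by (rule nn_integral_cmult) measurable
  also have "(\<integral>\<^sup>+x. (\<integral>\<^sup>+z. ennreal (W z) * ennreal ((V (x - a * z))\<^sup>2) \<partial>lborel) \<partial>lborel)
      = (\<integral>\<^sup>+z. (\<integral>\<^sup>+x. ennreal (W z) * ennreal ((V (x - a * z))\<^sup>2) \<partial>lborel) \<partial>lborel)"
    by (rule lborel_pair.Fubini'[symmetric]) measurable
  also have "\<dots> = ennreal (LINT z|lborel. W z) * (\<integral>\<^sup>+x. ennreal ((V x)\<^sup>2) \<partial>lborel)"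
    by (simp add: nn_integral_cmult shift nn_integral_multc IW)
  finally show ?thesis by (simp add: W(2) power2_eq_square ennreal_mult mult.assoc)
qed

section \<open>Schwartz functions\<close>

lemma decaying_class_schwartz: "decaying_class 4 schwartz"
  unfolding decaying_class_def
proof (intro allI impI conjI)
  fix f :: "real \<Rightarrow> complex" assume f: "schwartz f"
  define f' where "f' = (\<lambda>x. vector_derivative f (at x))"
  have shift: "nth_deriv n f' = nth_deriv (Suc n) f" for n
    unfolding nth_deriv_def f'_def by (simp add: funpow_Suc_right del: funpow.simps)
  have "schwartz f'" using f unfolding schwartz_def shift by blast
  moreover have "(f has_vector_derivative f' x) (at x)" for x
  proof -
    have "nth_deriv 0 f differentiable at x" using f unfolding schwartz_def by blast
    then show ?thesis by (simp add: nth_deriv_def f'_def vector_derivative_works)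
  qed
  ultimately show "\<exists>f'. schwartz f' \<and> (\<forall>x. (f has_vector_derivative f' x) (at x))" by blast
  have "\<exists>M. \<forall>x. \<bar>x\<bar> ^ k * norm (nth_deriv 0 f x) \<le> M" for k using f unfolding schwartz_def by blast
  from this[of 0] this[of 4] obtain M N where M: "\<And>x. norm (f x) \<le> M" and N: "\<And>x. \<bar>x\<bar> ^ 4 * norm (f x) \<le> N"
    by (auto simp: nth_deriv_def)
  have "norm (f x) \<le> (2 * M + 2 * N) * japanese x powr (- 4)" for x
  proof -
    have "japanese x ^ 4 = ((japanese x)\<^sup>2)\<^sup>2" by simp
    also have "\<dots> \<le> 2 + 2 * \<bar>x\<bar> ^ 4"
      unfolding japanese_power2 using sum_squares_bound[of 1 "x\<^sup>2"] by (simp add: power2_sum)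
    finally have "japanese x ^ 4 * norm (f x) \<le> (2 + 2 * \<bar>x\<bar> ^ 4) * norm (f x)" by (rule mult_right_mono) simp
    also have "\<dots> \<le> 2 * M + 2 * N" using M[of x] N[of x] by (simp add: algebra_simps)
    finally have "norm (f x) \<le> (2 * M + 2 * N) / japanese x ^ 4" by (simp add: pos_le_divide_eq mult.commute)
    moreover have "japanese x powr (- 4) = inverse (japanese x ^ 4)"
      by (simp add: powr_minus powr_numeral)
    ultimately show ?thesis by (simp add: divide_inverse)
  qed
  then show "\<exists>C. \<forall>x. norm (f x) \<le> C * japanese x powr (- 4)" by blast
qed

section \<open>Differences of the symbol\<close>

text \<open>
  For \<open>t \<in> [0, 1]\<close> one has \<open>t \<le> t powr a\<close>; apply this to the two fractions of \<open>x + y\<close>.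
\<close>

lemma powr_add_le:
  fixes x y a :: real
  assumes "0 \<le> x" "0 \<le> y" "0 < a" "a \<le> 1"
  shows "(x + y) powr a \<le> x powr a + y powr a"
proof (cases "x + y = 0")
  case False
  have le: "t / (x + y) \<le> (t / (x + y)) powr a" if "0 \<le> t" "t \<le> x + y" for t
    using powr_mono'[of a 1 "t / (x + y)"] assms that False by (auto simp: divide_simps)
  have "1 = x / (x + y) + y / (x + y)" using False by (simp add: add_divide_distrib[symmetric])
  also have "\<dots> \<le> (x / (x + y)) powr a + (y / (x + y)) powr a" using assms by (intro add_mono le) auto
  also have "\<dots> = (x powr a + y powr a) / (x + y) powr a"
    using assms by (simp add: powr_divide add_divide_distrib)
  finally show ?thesis using False assms by (simp add: divide_simps split: if_splits)
qed (use assms in auto)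

lemma abs_powr_diff_le:
  fixes x y a :: real
  assumes "0 \<le> x" "0 \<le> y" "0 < a" "a \<le> 1"
  shows "\<bar>x powr a - y powr a\<bar> \<le> \<bar>x - y\<bar> powr a"
  using powr_add_le[of y "x - y" a] powr_add_le[of x "y - x" a] powr_mono2[of a x y] powr_mono2[of a y x] assms
  by (cases "x \<le> y") auto

text \<open>
  The mean value theorem produces \<open>|x - y| z powr (a - 1)\<close> with \<open>z \<le> y + |x - y|\<close>, and the
  power with exponent \<open>a - 1 \<le> 1\<close> is again subadditive.
\<close>

lemma abs_powr_diff_le_above_one:
  fixes x y a :: real
  assumes "0 \<le> x" "0 \<le> y" "1 < a" "a \<le> 2"
  shows "\<bar>x powr a - y powr a\<bar> \<le> 2 * (\<bar>x - y\<bar> * y powr (a - 1) + \<bar>x - y\<bar> powr a)"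
proof (cases "x = y")
  case False
  define l r where "l = min x y" and "r = max x y"
  have lr: "0 \<le> l" "l < r" "r \<le> y + \<bar>x - y\<bar>" "\<bar>x - y\<bar> = r - l"
    using assms False by (auto simp: l_def r_def min_def max_def)
  obtain z where z: "l < z" "z < r" "r powr a - l powr a = (r - l) * (a * z powr (a - 1))"
  proof (rule mvt[OF lr(2), of "\<lambda>z. z powr a" "\<lambda>z t. t * (a * z powr (a - 1))"])
    show "continuous_on {l..r} (\<lambda>z. z powr a)"
      using lr assms by (intro continuous_on_powr' continuous_intros) auto
    fix z assume "l < z" "z < r"
    then have "((\<lambda>z. z powr a) has_real_derivative a * z powr (a - 1)) (at z)"
      using lr by (intro has_real_derivative_powr) auto
    then show "((\<lambda>z. z powr a) has_derivative (\<lambda>t. t * (a * z powr (a - 1)))) (at z)"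
      by (simp add: has_field_derivative_def mult.commute[of _ "a * z powr (a - 1)"])
  qed blast
  have "\<bar>x powr a - y powr a\<bar> = r powr a - l powr a"
    using lr powr_mono2[of a l r] assms by (auto simp: l_def r_def min_def max_def split: if_splits)
  also have "\<dots> = a * (\<bar>x - y\<bar> * z powr (a - 1))" using z lr by simp
  also have "\<dots> \<le> 2 * (\<bar>x - y\<bar> * (y powr (a - 1) + \<bar>x - y\<bar> powr (a - 1)))"
  proof (intro mult_mono order_refl)
    have "z powr (a - 1) \<le> (y + \<bar>x - y\<bar>) powr (a - 1)" using z lr assms by (intro powr_mono2) auto
    also have "\<dots> \<le> y powr (a - 1) + \<bar>x - y\<bar> powr (a - 1)" using assms by (intro powr_add_le) auto
    finally show "z powr (a - 1) \<le> y powr (a - 1) + \<bar>x - y\<bar> powr (a - 1)" .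
  qed (use assms in auto)
  also have "\<dots> = 2 * (\<bar>x - y\<bar> * y powr (a - 1) + \<bar>x - y\<bar> powr 1 * \<bar>x - y\<bar> powr (a - 1))"
    by (simp add: algebra_simps)
  also have "\<bar>x - y\<bar> powr 1 * \<bar>x - y\<bar> powr (a - 1) = \<bar>x - y\<bar> powr a"
    unfolding powr_add[symmetric] by simp
  finally show ?thesis .
qed (use assms in auto)

text \<open>
  These two numbers merge the two cases of the estimate: the Sobolev order of the norm of \<open>u\<close> and the power of
  \<open>1 / A\<close>.
\<close>

definition sobolev_order :: "real \<Rightarrow> real" where
  "sobolev_order \<alpha> = (if \<alpha> \<le> 1 then 0 else \<alpha> / 2)"

definition decay_rate :: "real \<Rightarrow> real" where
  "decay_rate \<alpha> = (if \<alpha> \<le> 1 then \<alpha> else \<alpha> / 2)"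

text \<open>
  The frequency \<open>\<zeta>\<close>, the scale \<open>a\<close> and the frequency \<open>\<xi> - a \<zeta>\<close> of \<open>u\<close> are separated
  here.  For \<open>\<alpha> > 1\<close> the powers \<open>|a|\<close> and \<open>|a| powr \<alpha>\<close> that arise are both at most
  \<open>|a| powr (\<alpha> / 2)\<close>.
\<close>

lemma abs_powr_symbol_diff:
  assumes alpha: "0 < \<alpha>" "\<alpha> \<le> 2" and a: "\<bar>a\<bar> \<le> 1"
  shows "\<bar>\<bar>\<xi>\<bar> powr \<alpha> - \<bar>\<xi> - a * \<zeta>\<bar> powr \<alpha>\<bar>
     \<le> 2 * \<bar>a\<bar> powr decay_rate \<alpha> * (\<bar>\<zeta>\<bar> powr \<alpha> + \<bar>\<zeta>\<bar>) * japanese (\<xi> - a * \<zeta>) powr sobolev_order \<alpha>"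
proof -
  define \<eta> where "\<eta> = \<xi> - a * \<zeta>"
  have d: "\<bar>\<bar>\<xi>\<bar> - \<bar>\<eta>\<bar>\<bar> \<le> \<bar>a\<bar> * \<bar>\<zeta>\<bar>"
    unfolding abs_mult[symmetric] \<eta>_def by linarith
  have dp: "\<bar>\<bar>\<xi>\<bar> - \<bar>\<eta>\<bar>\<bar> powr \<alpha> \<le> \<bar>a\<bar> powr \<alpha> * \<bar>\<zeta>\<bar> powr \<alpha>"
    using powr_mono2[OF _ _ d, of \<alpha>] alpha by (simp add: powr_mult)
  have "\<bar>\<bar>\<xi>\<bar> powr \<alpha> - \<bar>\<eta>\<bar> powr \<alpha>\<bar> \<le> 2 * \<bar>a\<bar> powr decay_rate \<alpha> * (\<bar>\<zeta>\<bar> powr \<alpha> + \<bar>\<zeta>\<bar>) * japanese \<eta> powr sobolev_order \<alpha>"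
  proof (cases "\<alpha> \<le> 1")
    case True
    have "\<bar>\<bar>\<xi>\<bar> powr \<alpha> - \<bar>\<eta>\<bar> powr \<alpha>\<bar> \<le> \<bar>a\<bar> powr \<alpha> * \<bar>\<zeta>\<bar> powr \<alpha>"
      using abs_powr_diff_le[of "\<bar>\<xi>\<bar>" "\<bar>\<eta>\<bar>" \<alpha>] dp alpha True by simp
    also have "\<dots> \<le> 2 * \<bar>a\<bar> powr \<alpha> * (\<bar>\<zeta>\<bar> powr \<alpha> + \<bar>\<zeta>\<bar>)"
      by (simp add: algebra_simps)
    finally show ?thesis using True
      by (simp add: decay_rate_def sobolev_order_def)
  next
    case False
    define A where "A = \<bar>a\<bar> powr (\<alpha> / 2)"
    define S where "S = japanese \<eta> powr (\<alpha> / 2)"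
    have A: "\<bar>a\<bar> powr \<alpha> \<le> A" "\<bar>a\<bar> \<le> A" "0 \<le> A"
      using powr_mono'[of "\<alpha> / 2" \<alpha> "\<bar>a\<bar>"] powr_mono'[of "\<alpha> / 2" 1 "\<bar>a\<bar>"] a alpha by (auto simp: A_def)
    have S: "1 \<le> S" "\<bar>\<eta>\<bar> powr (\<alpha> - 1) \<le> S"
    proof -
      show "1 \<le> S" unfolding S_def using japanese_ge_1 alpha by (intro ge_one_powr_ge_zero) auto
      have "\<bar>\<eta>\<bar> powr (\<alpha> - 1) \<le> japanese \<eta> powr (\<alpha> - 1)" using False by (intro powr_mono2 abs_le_japanese) auto
      also have "\<dots> \<le> S" unfolding S_def using alpha japanese_ge_1 by (intro powr_mono) auto
      finally show "\<bar>\<eta>\<bar> powr (\<alpha> - 1) \<le> S" .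
    qed
    have "\<bar>\<bar>\<xi>\<bar> powr \<alpha> - \<bar>\<eta>\<bar> powr \<alpha>\<bar> \<le> 2 * (\<bar>\<bar>\<xi>\<bar> - \<bar>\<eta>\<bar>\<bar> * \<bar>\<eta>\<bar> powr (\<alpha> - 1) + \<bar>\<bar>\<xi>\<bar> - \<bar>\<eta>\<bar>\<bar> powr \<alpha>)"
      using False alpha by (intro abs_powr_diff_le_above_one) auto
    also have "\<dots> \<le> 2 * ((A * \<bar>\<zeta>\<bar>) * S + (A * \<bar>\<zeta>\<bar> powr \<alpha>) * S)"
    proof (intro mult_left_mono add_mono mult_mono)
      show "\<bar>\<bar>\<xi>\<bar> - \<bar>\<eta>\<bar>\<bar> \<le> A * \<bar>\<zeta>\<bar>" by (rule order_trans[OF d mult_right_mono[OF A(2)]]) simp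
      have "\<bar>\<bar>\<xi>\<bar> - \<bar>\<eta>\<bar>\<bar> powr \<alpha> \<le> A * \<bar>\<zeta>\<bar> powr \<alpha>" by (rule order_trans[OF dp mult_right_mono[OF A(1)]]) simp
      also have "\<dots> \<le> (A * \<bar>\<zeta>\<bar> powr \<alpha>) * S" using mult_left_mono[OF S(1), of "A * \<bar>\<zeta>\<bar> powr \<alpha>"] A by simp
      finally show "\<bar>\<bar>\<xi>\<bar> - \<bar>\<eta>\<bar>\<bar> powr \<alpha> \<le> (A * \<bar>\<zeta>\<bar> powr \<alpha>) * S" .
    qed (use A S in auto)
    also have "\<dots> = 2 * A * (\<bar>\<zeta>\<bar> powr \<alpha> + \<bar>\<zeta>\<bar>) * S" by (simp add: algebra_simps)
    finally show ?thesis using False by (simp add: A_def S_def decay_rate_def sobolev_order_def)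
  qed
  then show ?thesis by (simp add: \<eta>_def)
qed

section \<open>Commutators with Fourier multipliers\<close>

lemma schwartz_integrable: "schwartz u \<Longrightarrow> integrable lborel u"
  by (rule decaying_integrable[OF decaying_class_schwartz]) simp

lemma inverse_square_le_japanese: "1 / (1 + \<bar>x\<bar>)\<^sup>2 \<le> japanese x powr (- 2)"
  unfolding japanese_powr_minus_2 by (intro divide_left_mono) (auto simp: power2_sum add_pos_nonneg)

lemma integral_cis_mult_translate:
  fixes v :: "real \<Rightarrow> complex"
  shows "(LINT \<xi>|lborel. cis (x * \<xi>) * v (\<xi> - h)) = cis (x * h) * (LINT \<xi>|lborel. cis (x * \<xi>) * v \<xi>)"
proof -
  have "(LINT \<xi>|lborel. cis (x * \<xi>) * v (\<xi> - h)) = (LINT \<xi>|lborel. cis (x * (h + 1 * \<xi>)) * v (h + 1 * \<xi> - h))"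
    using lborel_integral_real_affine[of 1 "\<lambda>\<xi>. cis (x * \<xi>) * v (\<xi> - h)" h] by simp
  also have "\<dots> = (LINT \<xi>|lborel. cis (x * h) * (cis (x * \<xi>) * v \<xi>))"
    by (simp add: cis_mult distrib_left mult.assoc[symmetric])
  finally show ?thesis by simp
qed

text \<open>
  The commutator formula holds for any multiplier \<open>m\<close> of at most quadratic growth.
  The last assumption is the only place where the size of the commutator is encoded; \<open>W\<close> becomes the kernel in
  Young's inequality.
\<close>

context
  fixes u :: "real \<Rightarrow> complex" and H :: "real \<Rightarrow> complex" and g m W :: "real \<Rightarrow> real"
    and a s :: real and c :: complex
  assumes u: "schwartz u"
    and Hm [measurable]: "H \<in> borel_measurable borel"
    and H_int: "\<And>n. integrable lborel (\<lambda>\<zeta>. \<bar>\<zeta>\<bar> * (1 + \<bar>\<zeta>\<bar>) ^ n * norm (H \<zeta>))"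
    and g: "\<And>x. complex_of_real (g x) = c + (LINT \<zeta>|lborel. (cis (x * (a * \<zeta>)) - 1) * H \<zeta>)"
    and a: "\<bar>a\<bar> \<le> 1"
    and mm [measurable]: "m \<in> borel_measurable borel"
    and m_growth: "\<And>\<xi>. \<bar>m \<xi>\<bar> \<le> (1 + \<bar>\<xi>\<bar>)\<^sup>2"
    and W_int: "integrable lborel W" and W_nonneg: "\<And>\<zeta>. 0 \<le> W \<zeta>"
    and s: "s \<le> 1"
    and m_diff: "\<And>\<xi> \<zeta>. \<bar>m \<xi> - m (\<xi> - a * \<zeta>)\<bar> * norm (H \<zeta>) \<le> W \<zeta> * japanese (\<xi> - a * \<zeta>) powr s"
begin

lemma u_integrable: "integrable lborel u"
  by (rule schwartz_integrable[OF u])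

lemma u_measurable [measurable]: "u \<in> borel_measurable borel"
  using borel_measurable_integrable[OF u_integrable] by simp

lemma fourier_u_measurable [measurable]: "fourier u \<in> borel_measurable borel"
  by (rule measurable_fourier[OF u_integrable])

lemma fourier_u_decay: "\<exists>C\<ge>0. \<forall>\<xi>. (1 + \<bar>\<xi>\<bar>) ^ n * norm (fourier u \<xi>) \<le> C"
  by (rule fourier_decay[OF decaying_class_schwartz _ u]) simp

lemma weighted_fourier_u_integrable:
  assumes [measurable]: "w \<in> borel_measurable borel" and w: "\<And>\<xi>. \<bar>w \<xi>\<bar> \<le> (1 + \<bar>\<xi>\<bar>)\<^sup>2"
  shows "integrable lborel (\<lambda>\<xi>. w \<xi> *\<^sub>R fourier u \<xi>)"
proof -
  obtain C where C: "C \<ge> 0" "\<And>\<xi>. (1 + \<bar>\<xi>\<bar>) ^ 4 * norm (fourier u \<xi>) \<le> C" using fourier_u_decay by blast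
  show ?thesis
  proof (rule Bochner_Integration.integrable_bound[OF integrable_mult_right[OF integrable_japanese_powr[of 2], of C]])
    show "AE \<xi> in lborel. norm (w \<xi> *\<^sub>R fourier u \<xi>) \<le> norm (C * japanese \<xi> powr (- 2))"
    proof (rule AE_I2)
      fix \<xi> :: real
      have "norm (w \<xi> *\<^sub>R fourier u \<xi>) \<le> (1 + \<bar>\<xi>\<bar>)\<^sup>2 * norm (fourier u \<xi>)"
        unfolding norm_scaleR by (intro mult_right_mono w) simp
      also have "\<dots> = ((1 + \<bar>\<xi>\<bar>) ^ 4 * norm (fourier u \<xi>)) * (1 / (1 + \<bar>\<xi>\<bar>)\<^sup>2)"
        by (simp add: divide_simps power2_eq_square power4_eq_xxxx)
      also have "\<dots> \<le> C * japanese \<xi> powr (- 2)"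
        using C by (intro mult_mono inverse_square_le_japanese) auto
      finally show "norm (w \<xi> *\<^sub>R fourier u \<xi>) \<le> norm (C * japanese \<xi> powr (- 2))" by simp
    qed
  qed auto
qed

lemma multiplied_fourier_u_integrable: "integrable lborel (\<lambda>\<xi>. m \<xi> *\<^sub>R fourier u \<xi>)"
  by (rule weighted_fourier_u_integrable) (auto intro: m_growth)

lemma sobolev_weighted_fourier_u_integrable: "integrable lborel (\<lambda>\<xi>. japanese \<xi> powr s * norm (fourier u \<xi>))"
proof -
  have "\<bar>japanese \<xi> powr s\<bar> \<le> (1 + \<bar>\<xi>\<bar>)\<^sup>2" for \<xi>
  proof -
    have "japanese \<xi> powr s \<le> japanese \<xi> powr 1" using s japanese_ge_1 by (intro powr_mono) auto
    also have "\<dots> \<le> 1 + \<bar>\<xi>\<bar>" using japanese_le_1_plus_abs by simp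
    also have "\<dots> \<le> (1 + \<bar>\<xi>\<bar>)\<^sup>2" by (rule self_le_power) auto
    finally show ?thesis by simp
  qed
  then have "integrable lborel (\<lambda>\<xi>. japanese \<xi> powr s *\<^sub>R fourier u \<xi>)" by (intro weighted_fourier_u_integrable) auto
  from integrable_norm[OF this] show ?thesis by simp
qed

lemma xu_integrable: "integrable lborel (\<lambda>x. \<bar>x\<bar> * norm (u x))"
proof -
  obtain C where C: "C \<ge> 0" "\<And>x. norm (u x) \<le> C * japanese x powr (- 4)"
    using decaying_bound[OF decaying_class_schwartz _ u] by auto
  have "\<bar>x\<bar> * norm (u x) \<le> C * japanese x powr (- 3)" for x
  proof -
    have "\<bar>x\<bar> * norm (u x) \<le> japanese x * (C * japanese x powr (- 4))"
      using C abs_le_japanese by (intro mult_mono) auto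
    also have "\<dots> = C * (japanese x powr 1 * japanese x powr (- 4))" by simp
    also have "\<dots> = C * japanese x powr (- 3)" unfolding powr_add[symmetric] by simp
    finally show ?thesis .
  qed
  then show ?thesis
    using C(1) by (intro Bochner_Integration.integrable_bound[OF integrable_mult_right[OF integrable_japanese_powr[of 3], of C]]) auto
qed

lemma H_moment: "integrable lborel (\<lambda>\<zeta>. \<bar>\<zeta>\<bar> * norm (H \<zeta>))"
  using H_int[of 0] by simp

lemma H_cis_bound: "norm ((cis (x * (a * \<zeta>)) - 1) * H \<zeta>) \<le> \<bar>x\<bar> * (\<bar>\<zeta>\<bar> * norm (H \<zeta>))"
proof -
  have "norm ((cis (x * (a * \<zeta>)) - 1) * H \<zeta>) \<le> \<bar>x * (a * \<zeta>)\<bar> * norm (H \<zeta>)"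
    unfolding norm_mult by (intro mult_right_mono norm_cis_minus_one_le) simp
  also have "\<dots> = \<bar>a\<bar> * (\<bar>x\<bar> * (\<bar>\<zeta>\<bar> * norm (H \<zeta>)))" by (simp add: abs_mult mult_ac)
  also have "\<dots> \<le> 1 * (\<bar>x\<bar> * (\<bar>\<zeta>\<bar> * norm (H \<zeta>)))" by (intro mult_right_mono a) simp
  finally show ?thesis by simp
qed

text \<open>
  Multiplication by \<open>cis (a x \<zeta>)\<close> is translation by \<open>a \<zeta>\<close> on the Fourier side.
\<close>

lemma fourier_mult_op:
  "fourier (mult_op g u) \<xi> = c * fourier u \<xi> + (LINT \<zeta>|lborel. (fourier u (\<xi> - a * \<zeta>) - fourier u \<xi>) * H \<zeta>)"
proof -
  define Q where "Q x \<zeta> = cis (- (x * \<xi>)) * u x * ((cis (x * (a * \<zeta>)) - 1) * H \<zeta>)" for x \<zeta>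
  have Qm [measurable]: "case_prod Q \<in> borel_measurable (lborel \<Otimes>\<^sub>M lborel)" unfolding Q_def by measurable
  have Q: "integrable (lborel \<Otimes>\<^sub>M lborel) (case_prod Q)"
  proof (rule integrable_shear_bound[OF Qm H_moment xu_integrable, where a = 0])
    show "norm (Q x \<zeta>) \<le> \<bar>\<zeta>\<bar> * norm (H \<zeta>) * (\<bar>x - 0 * \<zeta>\<bar> * norm (u (x - 0 * \<zeta>)))" for x \<zeta>
      using mult_left_mono[OF H_cis_bound[of x \<zeta>], of "norm (u x)"] by (simp add: Q_def norm_mult mult_ac)
  qed
  have uc: "integrable lborel (\<lambda>x. cis (- (x * \<eta>)) * u x)" for \<eta>
    by (intro integrable_cis_mult u_integrable) simp
  have "fourier (mult_op g u) \<xi> = (LINT x|lborel. c * (cis (- (x * \<xi>)) * u x) + (LINT \<zeta>|lborel. Q x \<zeta>))"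
    unfolding fourier_def
  proof (rule Bochner_Integration.integral_cong[OF refl])
    fix x
    have "(LINT \<zeta>|lborel. Q x \<zeta>) = cis (- (x * \<xi>)) * u x * (LINT \<zeta>|lborel. (cis (x * (a * \<zeta>)) - 1) * H \<zeta>)"
      unfolding Q_def by simp
    then show "cis (- (x * \<xi>)) * mult_op g u x = c * (cis (- (x * \<xi>)) * u x) + (LINT \<zeta>|lborel. Q x \<zeta>)"
      unfolding mult_op_def scaleR_conv_of_real g by (simp add: algebra_simps)
  qed
  also have "\<dots> = c * fourier u \<xi> + (LINT x|lborel. LINT \<zeta>|lborel. Q x \<zeta>)"
    unfolding fourier_def using uc lborel_pair.integrable_fst[OF Q] by simp
  also have "(LINT x|lborel. LINT \<zeta>|lborel. Q x \<zeta>) = (LINT \<zeta>|lborel. LINT x|lborel. Q x \<zeta>)"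
    by (rule lborel_pair.Fubini_integral[OF Q, symmetric])
  also have "\<dots> = (LINT \<zeta>|lborel. (fourier u (\<xi> - a * \<zeta>) - fourier u \<xi>) * H \<zeta>)"
  proof (rule Bochner_Integration.integral_cong[OF refl])
    fix \<zeta>
    have "Q x \<zeta> = (cis (- (x * (\<xi> - a * \<zeta>))) * u x - cis (- (x * \<xi>)) * u x) * H \<zeta>" for x
    proof -
      have "cis (- (x * (\<xi> - a * \<zeta>))) = cis (- (x * \<xi>)) * cis (x * (a * \<zeta>))" by (simp add: cis_mult algebra_simps)
      then show ?thesis unfolding Q_def by (simp add: algebra_simps)
    qed
    then have "(LINT x|lborel. Q x \<zeta>) = (LINT x|lborel. cis (- (x * (\<xi> - a * \<zeta>))) * u x - cis (- (x * \<xi>)) * u x) * H \<zeta>"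
      by (simp only: integral_mult_left_zero)
    then show "(LINT x|lborel. Q x \<zeta>) = (fourier u (\<xi> - a * \<zeta>) - fourier u \<xi>) * H \<zeta>"
      unfolding fourier_def by (simp only: Bochner_Integration.integral_diff[OF uc uc])
  qed
  finally show ?thesis .
qed

text \<open>
  The first kernel is the Fourier transform of \<open>m (D) ((cis (a x \<zeta>) - 1) u)\<close>, the second one that of the commutator
  of \<open>m (D)\<close> with \<open>cis (a x \<zeta>)\<close>, both times \<open>H \<zeta>\<close>.  Their difference is the transform of
  \<open>(cis (a x \<zeta>) - 1) (m (D) u)\<close>.
\<close>

definition shift_kernel :: "real \<Rightarrow> real \<Rightarrow> complex" where
  "shift_kernel \<xi> \<zeta> = m \<xi> *\<^sub>R ((fourier u (\<xi> - a * \<zeta>) - fourier u \<xi>) * H \<zeta>)"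

definition commutator_kernel :: "real \<Rightarrow> real \<Rightarrow> complex" where
  "commutator_kernel \<xi> \<zeta> = (m \<xi> - m (\<xi> - a * \<zeta>)) *\<^sub>R (fourier u (\<xi> - a * \<zeta>) * H \<zeta>)"

lemma shift_kernel_measurable [measurable]: "case_prod shift_kernel \<in> borel_measurable (lborel \<Otimes>\<^sub>M lborel)"
  unfolding shift_kernel_def by measurable

lemma commutator_kernel_measurable [measurable]: "case_prod commutator_kernel \<in> borel_measurable (lborel \<Otimes>\<^sub>M lborel)"
  unfolding commutator_kernel_def by measurable

text \<open>
  Near \<open>\<zeta> = 0\<close> the difference of the transforms gains a factor \<open>|\<zeta>|\<close> that compensates the pole of
  \<open>H\<close>.  Four powers of \<open>\<xi>\<close> are needed: two against the growth of \<open>m\<close> and two for integrability.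
\<close>

lemma shift_kernel_integrable: "integrable (lborel \<Otimes>\<^sub>M lborel) (case_prod shift_kernel)"
proof -
  obtain C where C: "C \<ge> 0"
    "\<And>\<xi> h. (1 + \<bar>\<xi>\<bar>) ^ 4 * norm (fourier u (\<xi> - h) - fourier u \<xi>) \<le> C * (\<bar>h\<bar> * (1 + \<bar>h\<bar>) ^ 4)"
    using fourier_difference_decay[OF decaying_class_schwartz _ _ u, of 4] by auto
  show ?thesis
  proof (rule integrable_shear_bound[OF shift_kernel_measurable integrable_mult_right[OF H_int[of 4], of C] integrable_japanese_powr[of 2], where a = 0])
    fix \<xi> \<zeta> :: real
    define d where "d = norm (fourier u (\<xi> - a * \<zeta>) - fourier u \<xi>)"
    have az: "\<bar>a * \<zeta>\<bar> \<le> \<bar>\<zeta>\<bar>" using mult_right_mono[OF a, of "\<bar>\<zeta>\<bar>"] by (simp add: abs_mult)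
    have "\<bar>m \<xi>\<bar> * d \<le> (1 + \<bar>\<xi>\<bar>)\<^sup>2 * d" unfolding d_def by (intro mult_right_mono m_growth) simp
    also have "\<dots> = ((1 + \<bar>\<xi>\<bar>) ^ 4 * d) * (1 / (1 + \<bar>\<xi>\<bar>)\<^sup>2)"
      by (simp add: divide_simps power2_eq_square power4_eq_xxxx)
    also have "\<dots> \<le> (C * (\<bar>a * \<zeta>\<bar> * (1 + \<bar>a * \<zeta>\<bar>) ^ 4)) * japanese \<xi> powr (- 2)"
      unfolding d_def using C(1) by (intro mult_mono C inverse_square_le_japanese) auto
    also have "\<dots> \<le> (C * (\<bar>\<zeta>\<bar> * (1 + \<bar>\<zeta>\<bar>) ^ 4)) * japanese \<xi> powr (- 2)"
      using C(1) az by (intro mult_right_mono mult_left_mono mult_mono power_mono) auto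
    finally have "\<bar>m \<xi>\<bar> * d * norm (H \<zeta>) \<le> \<dots> * norm (H \<zeta>)" by (rule mult_right_mono) simp
    then show "norm (shift_kernel \<xi> \<zeta>) \<le> C * (\<bar>\<zeta>\<bar> * (1 + \<bar>\<zeta>\<bar>) ^ 4 * norm (H \<zeta>)) * japanese (\<xi> - 0 * \<zeta>) powr (- 2)"
      by (simp add: shift_kernel_def norm_mult d_def mult_ac)
  qed simp
qed

lemma commutator_kernel_bound: "norm (commutator_kernel \<xi> \<zeta>) \<le> W \<zeta> * (japanese (\<xi> - a * \<zeta>) powr s * norm (fourier u (\<xi> - a * \<zeta>)))"
  using mult_right_mono[OF m_diff[of \<xi> \<zeta>], of "norm (fourier u (\<xi> - a * \<zeta>))"]
  by (simp add: commutator_kernel_def norm_mult mult_ac)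

lemma commutator_kernel_integrable: "integrable (lborel \<Otimes>\<^sub>M lborel) (case_prod commutator_kernel)"
  by (rule integrable_shear_bound[OF commutator_kernel_measurable W_int sobolev_weighted_fourier_u_integrable commutator_kernel_bound])

lemma cis_pair_integrable:
  assumes "integrable (lborel \<Otimes>\<^sub>M lborel) (case_prod F)"
  shows "integrable (lborel \<Otimes>\<^sub>M lborel) (\<lambda>(\<xi>, \<zeta>). cis (x * \<xi>) * (F \<xi> \<zeta> :: complex))"
  by (rule Bochner_Integration.integrable_bound[OF assms])
     (use borel_measurable_integrable[OF assms] in \<open>auto simp: norm_mult split_beta'\<close>)

text \<open>
  Both terms of the commutator contain \<open>c m (D) u\<close>, which cancels.  The remaining parts are integrals over
  \<open>(\<xi>, \<zeta>)\<close> of two kernels whose difference is \<open>commutator_kernel\<close>; all three kernels are integrable on the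
  product, so the order of integration is immaterial.
\<close>

theorem commutator_eq_inverse_fourier:
  "commutator (fourier_multiplier m) (mult_op g) u x = inverse_fourier (\<lambda>\<xi>. LINT \<zeta>|lborel. commutator_kernel \<xi> \<zeta>) x"
proof -
  define v where "v \<xi> = m \<xi> *\<^sub>R fourier u \<xi>" for \<xi>
  have v: "integrable lborel v" unfolding v_def[abs_def] by (rule multiplied_fourier_u_integrable)
  have cv: "integrable lborel (\<lambda>\<xi>. cis (x * \<xi>) * v \<xi>)" by (intro integrable_cis_mult v) simp
  have cvh: "integrable lborel (\<lambda>\<xi>. cis (x * \<xi>) * v (\<xi> - h))" for h
    using lborel_integrable_real_affine[OF v, of 1 "- h"] by (intro integrable_cis_mult) auto
  define S where "S = (LINT \<xi>|lborel. cis (x * \<xi>) * v \<xi>)"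
  define translate_kernel where "translate_kernel \<xi> \<zeta> = (v (\<xi> - a * \<zeta>) - v \<xi>) * H \<zeta>" for \<xi> \<zeta>
  have translate_kernel: "translate_kernel \<xi> \<zeta> = shift_kernel \<xi> \<zeta> - commutator_kernel \<xi> \<zeta>" for \<xi> \<zeta>
    unfolding shift_kernel_def commutator_kernel_def translate_kernel_def v_def by (simp add: scaleR_conv_of_real algebra_simps)
  note I1 = cis_pair_integrable[OF shift_kernel_integrable, of x]
  note I2 = cis_pair_integrable[OF commutator_kernel_integrable, of x]
  have translate_kernel_pair: "(\<lambda>(\<xi>, \<zeta>). cis (x * \<xi>) * translate_kernel \<xi> \<zeta>)
      = (\<lambda>p. (case p of (\<xi>, \<zeta>) \<Rightarrow> cis (x * \<xi>) * shift_kernel \<xi> \<zeta>) - (case p of (\<xi>, \<zeta>) \<Rightarrow> cis (x * \<xi>) * commutator_kernel \<xi> \<zeta>))"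
    by (simp add: fun_eq_iff translate_kernel right_diff_distrib)
  have I3: "integrable (lborel \<Otimes>\<^sub>M lborel) (\<lambda>(\<xi>, \<zeta>). cis (x * \<xi>) * translate_kernel \<xi> \<zeta>)"
    unfolding translate_kernel_pair by (rule Bochner_Integration.integrable_diff[OF I1 I2])
  define T where "T F = (LINT \<xi>|lborel. LINT \<zeta>|lborel. cis (x * \<xi>) * F \<xi> \<zeta>)" for F :: "real \<Rightarrow> real \<Rightarrow> complex"
  have T3: "T translate_kernel = T shift_kernel - T commutator_kernel"
    unfolding T_def lborel_pair.integral_fst[OF I1] lborel_pair.integral_fst[OF I2] lborel_pair.integral_fst[OF I3]
    unfolding translate_kernel_pair by (rule Bochner_Integration.integral_diff[OF I1 I2])
  have 1: "(LINT \<xi>|lborel. cis (x * \<xi>) * (m \<xi> *\<^sub>R fourier (mult_op g u) \<xi>)) = c * S + T shift_kernel"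
  proof -
    have "(LINT \<xi>|lborel. cis (x * \<xi>) * (m \<xi> *\<^sub>R fourier (mult_op g u) \<xi>))
       = (LINT \<xi>|lborel. c * (cis (x * \<xi>) * v \<xi>) + (LINT \<zeta>|lborel. cis (x * \<xi>) * shift_kernel \<xi> \<zeta>))"
    proof (rule Bochner_Integration.integral_cong[OF refl])
      fix \<xi>
      have "(LINT \<zeta>|lborel. shift_kernel \<xi> \<zeta>) = m \<xi> *\<^sub>R (LINT \<zeta>|lborel. (fourier u (\<xi> - a * \<zeta>) - fourier u \<xi>) * H \<zeta>)"
        unfolding shift_kernel_def by simp
      then show "cis (x * \<xi>) * (m \<xi> *\<^sub>R fourier (mult_op g u) \<xi>) = c * (cis (x * \<xi>) * v \<xi>) + (LINT \<zeta>|lborel. cis (x * \<xi>) * shift_kernel \<xi> \<zeta>)"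
        unfolding fourier_mult_op v_def by (simp add: scaleR_conv_of_real algebra_simps)
    qed
    also have "\<dots> = c * S + T shift_kernel"
      unfolding S_def T_def using cv lborel_pair.integrable_fst[OF I1] by simp
    finally show ?thesis .
  qed
  have 2: "complex_of_real (g x) * S = c * S + T translate_kernel"
  proof -
    have "complex_of_real (g x) * S = c * S + (LINT \<zeta>|lborel. (cis (x * (a * \<zeta>)) - 1) * H \<zeta> * S)"
      unfolding g integral_mult_left_zero by (rule distrib_right)
    also have "(LINT \<zeta>|lborel. (cis (x * (a * \<zeta>)) - 1) * H \<zeta> * S) = (LINT \<zeta>|lborel. LINT \<xi>|lborel. cis (x * \<xi>) * translate_kernel \<xi> \<zeta>)"
    proof (rule Bochner_Integration.integral_cong[OF refl])
      fix \<zeta>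
      have "(LINT \<xi>|lborel. cis (x * \<xi>) * translate_kernel \<xi> \<zeta>) = (LINT \<xi>|lborel. (cis (x * \<xi>) * v (\<xi> - a * \<zeta>) - cis (x * \<xi>) * v \<xi>) * H \<zeta>)"
        unfolding translate_kernel_def by (simp add: algebra_simps)
      also have "\<dots> = ((LINT \<xi>|lborel. cis (x * \<xi>) * v (\<xi> - a * \<zeta>)) - S) * H \<zeta>"
        unfolding S_def by (simp only: integral_mult_left_zero Bochner_Integration.integral_diff[OF cvh cv])
      also have "(LINT \<xi>|lborel. cis (x * \<xi>) * v (\<xi> - a * \<zeta>)) = cis (x * (a * \<zeta>)) * S"
        unfolding S_def by (rule integral_cis_mult_translate)
      finally show "(cis (x * (a * \<zeta>)) - 1) * H \<zeta> * S = (LINT \<xi>|lborel. cis (x * \<xi>) * translate_kernel \<xi> \<zeta>)"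
        by (simp add: algebra_simps)
    qed
    also have "\<dots> = T translate_kernel"
      unfolding T_def by (rule lborel_pair.Fubini_integral[OF I3])
    finally show ?thesis .
  qed
  have "commutator (fourier_multiplier m) (mult_op g) u x
     = (LINT \<xi>|lborel. cis (x * \<xi>) * (m \<xi> *\<^sub>R fourier (mult_op g u) \<xi>)) / complex_of_real (2 * pi)
       - complex_of_real (g x) * S / complex_of_real (2 * pi)"
  proof -
    have "mult_op g h x = complex_of_real (g x) * h x" for h
      by (simp add: mult_op_def scaleR_conv_of_real)
    then show ?thesis
      by (simp add: commutator_def fourier_multiplier_def inverse_fourier_def S_def v_def)
  qed
  also have "\<dots> = T commutator_kernel / complex_of_real (2 * pi)"
    unfolding 1 2 T3 by (simp add: diff_divide_distrib add_divide_distrib)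
  also have "T commutator_kernel = (LINT \<xi>|lborel. cis (x * \<xi>) * (LINT \<zeta>|lborel. commutator_kernel \<xi> \<zeta>))"
    unfolding T_def by simp
  finally show ?thesis unfolding inverse_fourier_def .
qed

text \<open>
  The constant \<open>1 / (2 \<pi>)\<close> of the inverse transform and the factor \<open>sqrt (2 \<pi>)\<close> of the Plancherel
  inequality combine to the normalisation \<open>1 / sqrt (2 \<pi>)\<close> of the Sobolev norm.
\<close>

theorem commutator_multiplier_L2_bound:
  "L2_norm (commutator (fourier_multiplier m) (mult_op g) u) \<le> ennreal (LINT \<zeta>|lborel. W \<zeta>) * sobolev_norm s u"
proof -
  define K where "K \<xi> = (LINT \<zeta>|lborel. commutator_kernel \<xi> \<zeta>)" for \<xi>
  define M where "M = (LINT \<zeta>|lborel. W \<zeta>)"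
  have M: "M \<ge> 0" unfolding M_def by (simp add: W_nonneg)
  have K: "integrable lborel K" unfolding K_def[abs_def] by (rule lborel_pair.integrable_fst[OF commutator_kernel_integrable])
  note [measurable] = measurable_fourier[OF K]
  define V where "V \<xi> = japanese \<xi> powr s * norm (fourier u \<xi>)" for \<xi>
  have [measurable]: "V \<in> borel_measurable borel" unfolding V_def[abs_def] by measurable
  have inv: "inverse_fourier K x = fourier K (- x) / complex_of_real (2 * pi)" for x
    unfolding inverse_fourier_def fourier_def by (simp add: mult.commute)
  define IK where "IK = (\<integral>\<^sup>+\<xi>. ennreal ((norm (K \<xi>))\<^sup>2) \<partial>lborel)"
  define IV where "IV = (\<integral>\<^sup>+\<xi>. ennreal ((V \<xi>)\<^sup>2) \<partial>lborel)"
  define IF where "IF = (\<integral>\<^sup>+x. ennreal ((norm (fourier K x))\<^sup>2) \<partial>lborel)"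
  have IF: "IF \<le> ennreal (2 * pi) * IK"
    unfolding IF_def IK_def by (rule fourier_L2_bound[OF K])
  have IK: "IK \<le> ennreal (M\<^sup>2) * IV"
    unfolding IK_def IV_def K_def M_def
    by (rule young_L2[OF commutator_kernel_measurable W_int W_nonneg, where a = a])
       (use commutator_kernel_bound in \<open>auto simp: V_def\<close>)
  have reflect: "(\<integral>\<^sup>+x. ennreal ((norm (fourier K (- x)))\<^sup>2) \<partial>lborel) = IF"
    unfolding IF_def using nn_integral_real_affine[of "\<lambda>x. ennreal ((norm (fourier K x))\<^sup>2)" "-1" 0] by simp
  have "(\<integral>\<^sup>+x. ennreal ((norm (commutator (fourier_multiplier m) (mult_op g) u x))\<^sup>2) \<partial>lborel)
     = (\<integral>\<^sup>+x. ennreal (1 / (2 * pi)\<^sup>2) * ennreal ((norm (fourier K (- x)))\<^sup>2) \<partial>lborel)"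
  proof (rule nn_integral_cong)
    fix x
    have "(norm (fourier K (- x) / complex_of_real (2 * pi)))\<^sup>2 = 1 / (2 * pi)\<^sup>2 * (norm (fourier K (- x)))\<^sup>2"
      by (simp add: norm_divide power_divide)
    then show "ennreal ((norm (commutator (fourier_multiplier m) (mult_op g) u x))\<^sup>2)
      = ennreal (1 / (2 * pi)\<^sup>2) * ennreal ((norm (fourier K (- x)))\<^sup>2)"
      unfolding commutator_eq_inverse_fourier K_def[symmetric] inv
      by (simp only: ennreal_mult[symmetric] zero_le_power2 zero_le_divide_1_iff)
  qed
  also have "\<dots> = ennreal (1 / (2 * pi)\<^sup>2) * IF"
    unfolding reflect[symmetric] by (rule nn_integral_cmult) measurable
  also have "\<dots> \<le> ennreal (1 / (2 * pi)\<^sup>2) * (ennreal (2 * pi) * (ennreal (M\<^sup>2) * IV))"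
    by (rule mult_left_mono[OF order_trans[OF IF mult_left_mono[OF IK]]]) simp_all
  also have "\<dots> = ennreal ((M * (1 / sqrt (2 * pi)))\<^sup>2) * IV"
  proof -
    have "1 / (2 * pi)\<^sup>2 * (2 * pi * M\<^sup>2) = (M * (1 / sqrt (2 * pi)))\<^sup>2"
      by (simp add: power_mult_distrib power_divide power2_eq_square)
    then have "ennreal (1 / (2 * pi)\<^sup>2) * (ennreal (2 * pi) * ennreal (M\<^sup>2)) = ennreal ((M * (1 / sqrt (2 * pi)))\<^sup>2)"
      by (metis ennreal_mult mult_nonneg_nonneg pi_ge_zero zero_le_divide_1_iff zero_le_numeral zero_le_power2)
    then show ?thesis by (simp only: mult.assoc[symmetric])
  qed
  finally have le: "(\<integral>\<^sup>+x. ennreal ((norm (commutator (fourier_multiplier m) (mult_op g) u x))\<^sup>2) \<partial>lborel)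
     \<le> ennreal ((M * (1 / sqrt (2 * pi)))\<^sup>2) * IV" .
  have "L2_norm (commutator (fourier_multiplier m) (mult_op g) u)
     \<le> ennreal (M * (1 / sqrt (2 * pi))) * L2_norm (\<lambda>\<xi>. japanese \<xi> powr s *\<^sub>R fourier u \<xi>)"
    by (rule L2_norm_le) (use le M in \<open>auto simp: V_def IV_def\<close>)
  also have "\<dots> = ennreal M * sobolev_norm s u"
    unfolding sobolev_norm_def by (subst ennreal_mult) (use M in \<open>simp_all add: mult.assoc\<close>)
  finally show ?thesis unfolding M_def .
qed

end

section \<open>The commutator estimate\<close>

lemma sobolev_norm_0_le:
  assumes "integrable lborel u"
  shows "sobolev_norm 0 u \<le> L2_norm u"
proof -
  have "L2_norm (fourier u) \<le> ennreal (sqrt (2 * pi)) * L2_norm u"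
    by (rule L2_norm_le) (use fourier_L2_bound[OF assms] in auto)
  then have "ennreal (1 / sqrt (2 * pi)) * L2_norm (fourier u) \<le> ennreal (1 / sqrt (2 * pi)) * (ennreal (sqrt (2 * pi)) * L2_norm u)"
    by (rule mult_left_mono) simp
  also have "\<dots> = L2_norm u" by (simp add: mult.assoc[symmetric] ennreal_mult[symmetric])
  finally show ?thesis unfolding sobolev_norm_def by simp
qed

lemma abs_powr_growth:
  fixes \<alpha> \<xi> :: real
  assumes "0 < \<alpha>" "\<alpha> \<le> 2"
  shows "\<bar>\<bar>\<xi>\<bar> powr \<alpha>\<bar> \<le> (1 + \<bar>\<xi>\<bar>)\<^sup>2"
proof -
  have "\<bar>\<xi>\<bar> powr \<alpha> \<le> (1 + \<bar>\<xi>\<bar>) powr \<alpha>" using assms by (intro powr_mono2) auto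
  also have "\<dots> \<le> (1 + \<bar>\<xi>\<bar>) powr 2" using assms by (intro powr_mono) auto
  also have "\<dots> = (1 + \<bar>\<xi>\<bar>)\<^sup>2" by (simp add: powr_numeral)
  finally show ?thesis by simp
qed

theorem commutator_sqrt_phi_bound:
  assumes alpha: "0 < \<alpha>" "\<alpha> \<le> 2"
  obtains M where "M \<ge> 0"
    "\<And>a u. \<bar>a\<bar> \<le> 1 \<Longrightarrow> schwartz u \<Longrightarrow>
       L2_norm (commutator (abs_D \<alpha>) (mult_op (\<lambda>y. sqrt (phi \<alpha> (a * y)))) u)
       \<le> ennreal (M * \<bar>a\<bar> powr decay_rate \<alpha>) * sobolev_norm (sobolev_order \<alpha>) u"
proof -
  obtain H where Hm [measurable]: "H \<in> borel_measurable borel"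
    and H1: "integrable lborel (\<lambda>\<zeta>. \<bar>\<zeta>\<bar> powr \<alpha> * norm (H \<zeta>))"
    and H2: "\<And>n. integrable lborel (\<lambda>\<zeta>. \<bar>\<zeta>\<bar> * (1 + \<bar>\<zeta>\<bar>) ^ n * norm (H \<zeta>))"
    and rep: "\<And>x. complex_of_real (sqrt (phi \<alpha> x))
       = complex_of_real (sqrt (phi \<alpha> 0)) + (LINT \<zeta>|lborel. (cis (x * \<zeta>) - 1) * H \<zeta>)"
    by (rule sqrt_phi_representation[OF alpha(1)]) (rule that)
  define w where "w \<zeta> = 2 * ((\<bar>\<zeta>\<bar> powr \<alpha> + \<bar>\<zeta>\<bar>) * norm (H \<zeta>))" for \<zeta>
  have w: "integrable lborel w"
    unfolding w_def[abs_def] distrib_right using H1 H2[of 0] by simp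
  show ?thesis
  proof (rule that)
    show "(LINT \<zeta>|lborel. w \<zeta>) \<ge> 0" by (simp add: w_def)
    fix a :: real and u assume a: "\<bar>a\<bar> \<le> 1" and u: "schwartz u"
    have "L2_norm (commutator (fourier_multiplier (\<lambda>\<xi>. \<bar>\<xi>\<bar> powr \<alpha>)) (mult_op (\<lambda>y. sqrt (phi \<alpha> (a * y)))) u)
      \<le> ennreal (LINT \<zeta>|lborel. w \<zeta> * \<bar>a\<bar> powr decay_rate \<alpha>) * sobolev_norm (sobolev_order \<alpha>) u"
    proof (rule commutator_multiplier_L2_bound[OF u Hm H2 _ a])
      show "complex_of_real (sqrt (phi \<alpha> (a * x))) = complex_of_real (sqrt (phi \<alpha> 0)) + (LINT \<zeta>|lborel. (cis (x * (a * \<zeta>)) - 1) * H \<zeta>)" for x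
        using rep[of "a * x"] by (simp add: mult_ac)
      show "\<bar>\<bar>\<xi>\<bar> powr \<alpha>\<bar> \<le> (1 + \<bar>\<xi>\<bar>)\<^sup>2" for \<xi> by (rule abs_powr_growth[OF alpha])
      show "sobolev_order \<alpha> \<le> 1" using alpha by (simp add: sobolev_order_def)
      show "\<bar>\<bar>\<xi>\<bar> powr \<alpha> - \<bar>\<xi> - a * \<zeta>\<bar> powr \<alpha>\<bar> * norm (H \<zeta>)
         \<le> w \<zeta> * \<bar>a\<bar> powr decay_rate \<alpha> * japanese (\<xi> - a * \<zeta>) powr sobolev_order \<alpha>" for \<xi> \<zeta>
        using mult_right_mono[OF abs_powr_symbol_diff[OF alpha a, of \<xi> \<zeta>], of "norm (H \<zeta>)"]
        by (simp add: w_def mult_ac)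
      show "integrable lborel (\<lambda>\<zeta>. w \<zeta> * \<bar>a\<bar> powr decay_rate \<alpha>)"
        by (intro integrable_mult_left w)
      show "0 \<le> w \<zeta> * \<bar>a\<bar> powr decay_rate \<alpha>" for \<zeta> by (simp add: w_def)
    qed measurable
    then show "L2_norm (commutator (abs_D \<alpha>) (mult_op (\<lambda>y. sqrt (phi \<alpha> (a * y)))) u)
      \<le> ennreal ((LINT \<zeta>|lborel. w \<zeta>) * \<bar>a\<bar> powr decay_rate \<alpha>) * sobolev_norm (sobolev_order \<alpha>) u"
      by (simp add: abs_D_def)
  qed
qed

theorem lemma30:
  fixes \<alpha> :: real
  assumes "0 < \<alpha>" and "\<alpha> \<le> 2"
  shows "\<exists>C::real. C > 0 \<and>
    (\<forall>(u :: real \<Rightarrow> complex) (A :: real). schwartz u \<longrightarrow> A > 1 \<longrightarrow>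
      L2_norm (commutator (abs_D \<alpha>) (mult_op (\<lambda>y. sqrt (phi_scaled \<alpha> A y))) u) +
      L2_norm (commutator (abs_D \<alpha>) (mult_op (\<lambda>y. sqrt (1 - phi_scaled \<alpha> A y))) u)
      \<le> (if \<alpha> \<le> 1
          then ennreal (C / A powr \<alpha>) * L2_norm u
          else ennreal (C / A powr (\<alpha> / 2)) * sobolev_norm (\<alpha> / 2) u))"
proof -
  obtain M where M: "M \<ge> 0"
    "\<And>a u. \<bar>a\<bar> \<le> 1 \<Longrightarrow> schwartz u \<Longrightarrow>
       L2_norm (commutator (abs_D \<alpha>) (mult_op (\<lambda>y. sqrt (phi \<alpha> (a * y)))) u)
       \<le> ennreal (M * \<bar>a\<bar> powr decay_rate \<alpha>) * sobolev_norm (sobolev_order \<alpha>) u"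
    by (rule commutator_sqrt_phi_bound[OF assms]) (rule that)
  define C where "C = 2 * M + 1"
  show ?thesis
  proof (intro exI[of _ C] conjI allI impI)
    show "C > 0" using M by (simp add: C_def)
    fix u :: "real \<Rightarrow> complex" and A :: real
    assume u: "schwartz u" and A: "A > 1"
    define N where "N = sobolev_norm (sobolev_order \<alpha>) u"
    define b where "b = (1 / A) powr decay_rate \<alpha>"
    have 1: "L2_norm (commutator (abs_D \<alpha>) (mult_op (\<lambda>y. sqrt (phi_scaled \<alpha> A y))) u) \<le> ennreal (M * b) * N"
      using M(2)[of "1 / A" u] A u by (simp add: phi_scaled_def N_def b_def)
    have 2: "L2_norm (commutator (abs_D \<alpha>) (mult_op (\<lambda>y. sqrt (1 - phi_scaled \<alpha> A y))) u) \<le> ennreal (M * b) * N"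
      using M(2)[of "- 1 / A" u] A u by (simp add: phi_scaled_def phi_minus[OF assms(1)] N_def b_def)
    have "L2_norm (commutator (abs_D \<alpha>) (mult_op (\<lambda>y. sqrt (phi_scaled \<alpha> A y))) u) +
      L2_norm (commutator (abs_D \<alpha>) (mult_op (\<lambda>y. sqrt (1 - phi_scaled \<alpha> A y))) u)
      \<le> ennreal (M * b) * N + ennreal (M * b) * N" by (rule add_mono[OF 1 2])
    also have "\<dots> = ennreal (2 * M * b) * N"
      using M(1) by (simp add: distrib_right[symmetric] ennreal_plus[symmetric] b_def del: ennreal_plus)
    also have "\<dots> \<le> ennreal (C * b) * N"
      by (intro mult_right_mono ennreal_leI) (auto simp: C_def b_def)
    also have "C * b = C / A powr decay_rate \<alpha>" using A by (simp add: b_def powr_divide)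
    also have "ennreal (C / A powr decay_rate \<alpha>) * N
      \<le> (if \<alpha> \<le> 1 then ennreal (C / A powr \<alpha>) * L2_norm u
          else ennreal (C / A powr (\<alpha> / 2)) * sobolev_norm (\<alpha> / 2) u)"
      using sobolev_norm_0_le[OF schwartz_integrable[OF u]]
      by (auto simp: N_def sobolev_order_def decay_rate_def intro: mult_left_mono)
    finally show "L2_norm (commutator (abs_D \<alpha>) (mult_op (\<lambda>y. sqrt (phi_scaled \<alpha> A y))) u) +
      L2_norm (commutator (abs_D \<alpha>) (mult_op (\<lambda>y. sqrt (1 - phi_scaled \<alpha> A y))) u)
      \<le> (if \<alpha> \<le> 1 then ennreal (C / A powr \<alpha>) * L2_norm u
          else ennreal (C / A powr (\<alpha> / 2)) * sobolev_norm (\<alpha> / 2) u)" .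
  qed
qed

end
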